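(* The space $S_1^2(\mathbb{D})$ (that is, its reproducing kernel) has the complete Pick property.
   Context: $\mathbb{D}$ is the open unit disk and $H(\mathbb{D})$ the space of analytic functions on $\mathbb{D}$; for $f\in H(\mathbb{D})$ write $f(z)=\sum_{n\ge 0}f_nz^n$. The derivative Hardy space is the Hilbert space $S_1^2(\mathbb{D})=\{f\in H(\mathbb{D}):\|f\|_{S_1^2}^2=\sum_{n\ge0}\frac{(n+1)(n+2)}{2}|f_n|^2<\infty\}$; its reproducing kernel is $K_w(z)=\sum_{n\ge0}\frac{2}{(n+1)(n+2)}(\overline{w}z)^n$. Let $H$ be a reproducing kernel Hilbert space of functions on a set $X$ with kernel $K_w(z)$. $H$ (or its kernel) has the $s\times t$ matrix Pick property if, for every $N\ge1$, all distinct points $\lambda_1,\dots,\lambda_N\in X$ and all complex $s\times t$ matrices $W_1,\dots,W_N$ such that the block (Pick) matrix $\left[(I_s-W_iW_j^* )K_{\lambda_j}(\lambda_i)\right]_{i,j=1}^N$ is positive semi-definite, there is an $s\times t$ matrix-valued function $\Phi$ on $X$ such that multiplication by $\Phi$ is a bounded operator from $H\otimes\mathbb{C}^t$ to $H\otimes\mathbb{C}^s$ of norm at most one and $\Phi(\lambda_i)=W_i$ for all $i$. $H$ has the complete Pick property if it has the $s\times t$ matrix Pick property for all positive integers $s,t$. *)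

theory Defs
  imports
    "HOL-Complex_Analysis.Complex_Analysis"
    "Jordan_Normal_Form.Schur_Decomposition"
begin

subsection \<open>Matrix Pick properties of a space of functions with a kernel\<close>

text \<open>
  A Hilbert space of functions on \<open>X\<close> is given by its carrier \<open>H\<close> and its norm \<open>nrm\<close>. HOL functions
  are total, so an element of the space is any HOL function that represents it: membership in \<open>H\<close>
  and \<open>nrm\<close> are meant to depend on the restriction to \<open>X\<close> only. The kernel \<open>K w z\<close> stands for
  \<open>K\<^sub>w(z)\<close>.
\<close>

definition psd_mat :: "nat \<Rightarrow> complex mat \<Rightarrow> bool" where
  "psd_mat n A \<longleftrightarrow>
     A \<in> carrier_mat n n \<and> mat_adjoint A = A \<and>
     (\<forall>v \<in> carrier_vec n. 0 \<le> Re ((A *\<^sub>v v) \<bullet>c v))"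

text \<open>
  The \<open>N \<times> N\<close> array of \<open>s \<times> s\<close> blocks flattened into one \<open>N * s\<close> square matrix: row \<open>p\<close> is row
  \<open>p mod s\<close> of block row \<open>p div s\<close>, and likewise for columns.
\<close>

definition pick_matrix ::
  "('x \<Rightarrow> 'x \<Rightarrow> complex) \<Rightarrow> nat \<Rightarrow> nat \<Rightarrow> (nat \<Rightarrow> 'x) \<Rightarrow> (nat \<Rightarrow> complex mat) \<Rightarrow> complex mat"
where
  "pick_matrix K s N \<zeta> W =
     mat (N * s) (N * s) (\<lambda>(p, q).
       (1\<^sub>m s - W (p div s) * mat_adjoint (W (q div s))) $$ (p mod s, q mod s)
       * K (\<zeta> (q div s)) (\<zeta> (p div s)))"

text \<open>
  An element of \<open>H \<otimes> \<complex>\<^sup>t\<close> is a \<open>t\<close>-tuple \<open>F 0, \<dots>, F (t - 1)\<close> of elements of \<open>H\<close>.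
\<close>

definition tuple_norm :: "(('x \<Rightarrow> complex) \<Rightarrow> real) \<Rightarrow> nat \<Rightarrow> (nat \<Rightarrow> 'x \<Rightarrow> complex) \<Rightarrow> real" where
  "tuple_norm nrm t F = sqrt (\<Sum>j<t. (nrm (F j))\<^sup>2)"

definition mult_op ::
  "nat \<Rightarrow> ('x \<Rightarrow> complex mat) \<Rightarrow> (nat \<Rightarrow> 'x \<Rightarrow> complex) \<Rightarrow> nat \<Rightarrow> 'x \<Rightarrow> complex"
where
  "mult_op t \<Phi> F i = (\<lambda>z. \<Sum>j<t. \<Phi> z $$ (i, j) * F j z)"

definition contractive_multiplier ::
  "'x set \<Rightarrow> ('x \<Rightarrow> complex) set \<Rightarrow> (('x \<Rightarrow> complex) \<Rightarrow> real) \<Rightarrow> nat \<Rightarrow> nat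
    \<Rightarrow> ('x \<Rightarrow> complex mat) \<Rightarrow> bool"
where
  "contractive_multiplier X H nrm s t \<Phi> \<longleftrightarrow>
     (\<forall>z\<in>X. \<Phi> z \<in> carrier_mat s t) \<and>
     (\<forall>F. (\<forall>j<t. F j \<in> H) \<longrightarrow>
        (\<forall>i<s. mult_op t \<Phi> F i \<in> H) \<and>
        tuple_norm nrm s (mult_op t \<Phi> F) \<le> tuple_norm nrm t F)"

definition matrix_pick_property ::
  "'x set \<Rightarrow> ('x \<Rightarrow> complex) set \<Rightarrow> (('x \<Rightarrow> complex) \<Rightarrow> real) \<Rightarrow> ('x \<Rightarrow> 'x \<Rightarrow> complex)
    \<Rightarrow> nat \<Rightarrow> nat \<Rightarrow> bool"
where
  "matrix_pick_property X H nrm K s t \<longleftrightarrow>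
     (\<forall>N \<zeta> W. 1 \<le> N \<longrightarrow> \<zeta> ` {..<N} \<subseteq> X \<longrightarrow> inj_on \<zeta> {..<N} \<longrightarrow>
        (\<forall>i<N. W i \<in> carrier_mat s t) \<longrightarrow>
        psd_mat (N * s) (pick_matrix K s N \<zeta> W) \<longrightarrow>
        (\<exists>\<Phi>. contractive_multiplier X H nrm s t \<Phi> \<and> (\<forall>i<N. \<Phi> (\<zeta> i) = W i)))"

definition complete_pick_property ::
  "'x set \<Rightarrow> ('x \<Rightarrow> complex) set \<Rightarrow> (('x \<Rightarrow> complex) \<Rightarrow> real) \<Rightarrow> ('x \<Rightarrow> 'x \<Rightarrow> complex) \<Rightarrow> bool"
where
  "complete_pick_property X H nrm K \<longleftrightarrow>
     (\<forall>s t. 1 \<le> s \<longrightarrow> 1 \<le> t \<longrightarrow> matrix_pick_property X H nrm K s t)"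

subsection \<open>The derivative Hardy space\<close>

abbreviation unit_disc :: "complex set" where
  "unit_disc \<equiv> ball 0 1"

definition taylor_coeff :: "(complex \<Rightarrow> complex) \<Rightarrow> nat \<Rightarrow> complex" where
  "taylor_coeff f n = (deriv ^^ n) f 0 / fact n"

definition S12_weight :: "nat \<Rightarrow> real" where
  "S12_weight n = (real n + 1) * (real n + 2) / 2"

definition S12 :: "(complex \<Rightarrow> complex) set" where
  "S12 = {f. f holomorphic_on unit_disc \<and>
             summable (\<lambda>n. S12_weight n * (cmod (taylor_coeff f n))\<^sup>2)}"

definition S12_norm :: "(complex \<Rightarrow> complex) \<Rightarrow> real" where
  "S12_norm f = sqrt (\<Sum>n. S12_weight n * (cmod (taylor_coeff f n))\<^sup>2)"

definition S12_kernel :: "complex \<Rightarrow> complex \<Rightarrow> complex" where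
  "S12_kernel w z = (\<Sum>n. 2 / ((of_nat n + 1) * (of_nat n + 2)) * (cnj w * z) ^ n)"

text \<open>
  The inner product that induces \<open>S12_norm\<close>; with respect to it \<open>S12_kernel\<close> is the reproducing
  kernel of \<open>S12\<close>.
\<close>

definition S12_inner :: "(complex \<Rightarrow> complex) \<Rightarrow> (complex \<Rightarrow> complex) \<Rightarrow> complex" where
  "S12_inner f g =
     (\<Sum>n. complex_of_real (S12_weight n) * taylor_coeff f n * cnj (taylor_coeff g n))"

lemma S12_inner_self:
  assumes "f \<in> S12"
  shows "S12_inner f f = complex_of_real ((S12_norm f)\<^sup>2)"
proof -
  let ?a = "\<lambda>n. S12_weight n * (cmod (taylor_coeff f n))\<^sup>2"
  have s: "summable ?a"
    using assms by (simp add: S12_def)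
  have nn: "0 \<le> ?a n" for n
    by (simp add: S12_weight_def)
  have "S12_inner f f = (\<Sum>n. complex_of_real (?a n))"
    unfolding S12_inner_def
    by (intro arg_cong[where f = suminf] ext)
       (simp only: of_real_mult mult.assoc complex_norm_square)
  also have "\<dots> = complex_of_real (suminf ?a)"
    by (rule suminf_of_real[OF s, symmetric])
  finally show ?thesis
    using suminf_nonneg[OF s nn] by (simp add: S12_norm_def)
qed

lemma S12_kernel_sums:
  assumes "w \<in> unit_disc" "z \<in> unit_disc"
  shows "(\<lambda>n. complex_of_real (1 / S12_weight n) * cnj w ^ n * z ^ n) sums S12_kernel w z"
proof -
  have eq: "complex_of_real (1 / S12_weight n) * cnj w ^ n * z ^ n
      = 2 / ((of_nat n + 1) * (of_nat n + 2)) * (cnj w * z) ^ n" for n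
    by (simp add: S12_weight_def power_mult_distrib)
  have le: "1 / S12_weight n \<le> 1" for n
  proof -
    have "(real n + 1) * (real n + 2) = real n * real n + 3 * real n + 2"
      by (simp add: algebra_simps)
    then have "1 \<le> S12_weight n"
      by (simp add: S12_weight_def)
    then show ?thesis by simp
  qed
  have w1: "cmod w < 1" and z1: "cmod z < 1"
    using assms by auto
  have "cmod w * cmod z < 1"
    using mult_strict_mono[OF w1 z1] by simp
  then have "summable (\<lambda>n. (cmod w * cmod z) ^ n)"
    by (intro summable_geometric) simp
  then have "summable (\<lambda>n. complex_of_real (1 / S12_weight n) * cnj w ^ n * z ^ n)"
  proof (rule summable_comparison_test'[where N = 0], goal_cases)
    case (1 n)
    have "cmod (complex_of_real (1 / S12_weight n) * cnj w ^ n * z ^ n)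
        = (1 / S12_weight n) * (cmod w * cmod z) ^ n"
      by (simp add: norm_mult norm_divide norm_power power_mult_distrib S12_weight_def
               del: of_real_mult of_real_divide)
    also have "\<dots> \<le> 1 * (cmod w * cmod z) ^ n"
      by (intro mult_right_mono le) simp
    finally show ?case by simp
  qed
  then show ?thesis
    unfolding S12_kernel_def eq by (rule summable_sums)
qed

lemma S12_kernel_holomorphic:
  assumes "w \<in> unit_disc"
  shows "S12_kernel w holomorphic_on unit_disc"
  by (rule power_series_holomorphic[where a = "\<lambda>n. complex_of_real (1 / S12_weight n) * cnj w ^ n"])
     (use S12_kernel_sums[OF assms] in simp)

lemma taylor_coeff_S12_kernel:
  assumes "w \<in> unit_disc"
  shows "taylor_coeff (S12_kernel w) n = complex_of_real (1 / S12_weight n) * cnj w ^ n"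
proof -
  have "S12_kernel w has_fps_expansion
          Abs_fps (\<lambda>n. complex_of_real (1 / S12_weight n) * cnj w ^ n)"
  proof (rule has_fps_expansionI)
    have "eventually (\<lambda>u::complex. u \<in> unit_disc) (nhds 0)"
      by (rule eventually_nhds_in_open) auto
    then show "eventually (\<lambda>u. (\<lambda>n. fps_nth
        (Abs_fps (\<lambda>n. complex_of_real (1 / S12_weight n) * cnj w ^ n)) n * u ^ n)
        sums S12_kernel w u) (nhds 0)"
      by eventually_elim (use S12_kernel_sums[OF assms] in simp)
  qed
  from fps_nth_fps_expansion[OF this, of n] show ?thesis
    by (simp add: taylor_coeff_def)
qed

lemma S12_kernel_in_S12:
  assumes "w \<in> unit_disc"
  shows "S12_kernel w \<in> S12"
proof -
  have "S12_weight n * (cmod (taylor_coeff (S12_kernel w) n))\<^sup>2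
      = Re (complex_of_real (1 / S12_weight n) * cnj w ^ n * w ^ n)" for n
  proof -
    have "cnj w ^ n * w ^ n = complex_of_real ((cmod w ^ n)\<^sup>2)"
      by (metis complex_norm_square complex_cnj_power mult.commute norm_power)
    moreover have "S12_weight n > 0"
      by (simp add: S12_weight_def)
    ultimately show ?thesis
      by (simp add: taylor_coeff_S12_kernel[OF assms] norm_mult norm_divide norm_power mult.assoc
            power_mult_distrib power_divide power2_eq_square field_simps
            flip: of_real_mult of_real_power)
  qed
  then have "summable (\<lambda>n. S12_weight n * (cmod (taylor_coeff (S12_kernel w) n))\<^sup>2)"
    using summable_Re[OF sums_summable[OF S12_kernel_sums[OF assms assms]]] by simp
  then show ?thesis
    using S12_kernel_holomorphic[OF assms] by (simp add: S12_def)
qed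

lemma S12_reproducing:
  assumes "f \<in> S12" "w \<in> unit_disc"
  shows "S12_inner f (S12_kernel w) = f w"
proof -
  have "complex_of_real (S12_weight n) * taylor_coeff f n * cnj (taylor_coeff (S12_kernel w) n)
      = (deriv ^^ n) f 0 / fact n * (w - 0) ^ n" for n
  proof -
    have "S12_weight n \<noteq> 0"
      by (simp add: S12_weight_def add_nonneg_eq_0_iff)
    then show ?thesis
      unfolding taylor_coeff_S12_kernel[OF assms(2)] by (simp add: taylor_coeff_def)
  qed
  moreover have "(\<lambda>n. (deriv ^^ n) f 0 / fact n * (w - 0) ^ n) sums f w"
    using assms by (intro holomorphic_power_series) (auto simp: S12_def)
  ultimately show ?thesis
    unfolding S12_inner_def by (simp add: sums_unique[symmetric])
qed

end

theory Submission
  imports Defs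
begin

text \<open>
  The kernel coefficients \<open>a\<^sub>n = 2 / ((n + 1) (n + 2))\<close> satisfy \<open>a\<^sub>0 = 1\<close> and are log-convex. Kaluza's
  lemma then gives \<open>K\<^sub>w(z) = 1 / (1 - L\<^sub>w(z))\<close> with \<open>L\<^sub>w(z) = (\<Sum>n\<ge>1. b\<^sub>n (cnj w * z)\<^sup>n)\<close> and all \<open>b\<^sub>n \<ge> 0\<close>,
  or equivalently the renewal equation \<open>a\<^sub>k = (\<Sum>n=1..k. b\<^sub>n a\<^sub>k\<^sub>-\<^sub>n)\<close> for \<open>k \<ge> 1\<close>.

  Let \<open>P\<close> be a positive semi-definite Pick matrix, with one index for each pair of a node and a row of
  its target matrix. Write \<open>w\<^sub>p\<close> for row \<open>p\<close> of the targets. Multiplying \<open>P\<close> entrywise by \<open>1 - L\<close> removes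
  the kernel: \<open>P\<^sub>p\<^sub>q (1 - L\<^sub>p\<^sub>q) = \<delta>\<^sub>p\<^sub>q - \<langle>w\<^sub>p, w\<^sub>q\<rangle>\<close>, where \<open>\<delta>\<^sub>p\<^sub>q\<close> compares row numbers. Hence
  \<open>\<langle>w\<^sub>p, w\<^sub>q\<rangle> + P\<^sub>p\<^sub>q = \<delta>\<^sub>p\<^sub>q + P\<^sub>p\<^sub>q L\<^sub>p\<^sub>q\<close>. Both sides are Gram matrices: the left one of vectors in the sum of
  the input space \<open>\<complex>\<^sup>t\<close> and a state space with Gram matrix \<open>P\<close>; the right one of vectors in the sum of the
  output space \<open>\<complex>\<^sup>s\<close> and one copy of the state space for each \<open>n \<ge> 1\<close>, weighted by \<open>b\<^sub>n\<close>. Mapping the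
  first family of vectors to the second is isometric on its span, and following the orthogonal
  projection onto that span it becomes a contraction \<open>V\<close> from (input, state) to (output, branches).
  This is the lurking isometry argument.

  Now feed branch \<open>n\<close> back into the state with delay \<open>n\<close> and gain \<open>\<surd>b\<^sub>n\<close>. The resulting linear system
  acts on coefficient sequences by convolution with a power series matrix \<open>\<Phi>\<close>, its transfer function.

  \<^item> \<open>\<Phi>\<close> is a contractive multiplier. By convexity and the renewal equation, the energy of the
    state at time \<open>k\<close>, with weight \<open>1 / a\<^sub>k\<close>, is at most the weighted energy of the branches that enter
    it. Since \<open>V\<close> is contractive, summing over the times below \<open>M\<close> makes the state energies cancel;
    the energy of the output up to \<open>M\<close> is at most that of the input
    (\<open>energy_inequality\<close>).
  \<^item> \<open>\<Phi>\<close> interpolates. On the defining vectors the adjoint of \<open>V\<close> inverts \<open>V\<close>, and at a node \<open>\<zeta>\<^sub>p\<close> the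
    feedback series takes precisely the values \<open>L\<^sub>p\<^sub>q\<close>, so the state terms cancel and the output is
    \<open>w\<^sub>p\<close> applied to the input (\<open>transfer_interpolates\<close>).

  The energy estimates concern finitely many coefficients at a time, so apart from the series for
  \<open>L\<close>, which converges geometrically, convergence enters only when \<open>\<Phi>\<close> is evaluated.
\<close>

section \<open>Semi-inner products on function spaces\<close>

locale semi_inner =
  fixes ip :: "('i \<Rightarrow> complex) \<Rightarrow> ('i \<Rightarrow> complex) \<Rightarrow> complex"
  assumes add_scale_left: "ip (\<lambda>i. x i + c * y i) z = ip x z + c * ip y z"
    and conj_sym: "ip y x = cnj (ip x y)"
    and self_nonneg: "0 \<le> Re (ip x x)"
begin

lemma zero_left: "ip (\<lambda>i. 0) z = 0"
  using add_scale_left[of "\<lambda>i. 0" "-1" "\<lambda>i. 0" z] by simp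

lemma sum_left: "ip (\<lambda>i. \<Sum>b\<in>A. c b * q b i) z = (\<Sum>b\<in>A. c b * ip (q b) z)"
proof (induction A rule: infinite_finite_induct)
  case (insert a A)
  have "ip (\<lambda>i. (\<Sum>b\<in>A. c b * q b i) + c a * q a i) z
      = ip (\<lambda>i. \<Sum>b\<in>A. c b * q b i) z + c a * ip (q a) z"
    by (rule add_scale_left)
  with insert show ?case by (simp add: add.commute)
qed (simp_all add: zero_left)

lemma add_left: "ip (\<lambda>i. x i + y i) z = ip x z + ip y z"
  using add_scale_left[of x 1 y z] by simp

lemma diff_left: "ip (\<lambda>i. x i - y i) z = ip x z - ip y z"
  using add_scale_left[of x "-1" y z] by simp

lemma add_scale_right: "ip z (\<lambda>i. x i + c * y i) = ip z x + cnj c * ip z y"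
  by (subst (1 2 3) conj_sym) (simp add: add_scale_left)

lemma add_right: "ip z (\<lambda>i. x i + y i) = ip z x + ip z y"
  using add_scale_right[of z x 1 y] by simp

lemma sum_right: "ip z (\<lambda>i. \<Sum>b\<in>A. c b * q b i) = (\<Sum>b\<in>A. cnj (c b) * ip z (q b))"
proof -
  have "ip z (\<lambda>i. \<Sum>b\<in>A. c b * q b i) = cnj (\<Sum>b\<in>A. c b * ip (q b) z)"
    by (subst conj_sym) (simp only: sum_left)
  also have "\<dots> = (\<Sum>b\<in>A. cnj (c b) * cnj (ip (q b) z))"
    by simp
  also have "\<dots> = (\<Sum>b\<in>A. cnj (c b) * ip z (q b))"
    by (simp only: conj_sym[symmetric])
  finally show ?thesis .
qed

lemma self_real: "ip x x = complex_of_real (Re (ip x x))"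
  using conj_sym[of x x] by (simp add: complex_eq_iff)

text \<open>
  Expand \<open>ip (x - l \<langle>x, y\<rangle> y) (x - l \<langle>x, y\<rangle> y) \<ge> 0\<close> for real \<open>l\<close>. The form may be degenerate, so a null
  vector \<open>y\<close> is a genuine case: there the expression is affine in \<open>l\<close>, which forces \<open>\<langle>x, y\<rangle> = 0\<close>.
\<close>

theorem Cauchy_Schwarz: "(cmod (ip x y))\<^sup>2 \<le> Re (ip x x) * Re (ip y y)"
proof -
  define T where "T = (cmod (ip x y))\<^sup>2"
  have expand: "0 \<le> Re (ip x x) - 2 * l * T + l\<^sup>2 * T * Re (ip y y)" for l :: real
  proof -
    define c where "c = - (of_real l * ip x y)"
    have T: "ip x y * cnj (ip x y) = of_real T"
      unfolding T_def complex_norm_square ..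
    have "ip (\<lambda>i. x i + c * y i) (\<lambda>i. x i + c * y i)
        = ip x x + (cnj c * ip x y + c * cnj (ip x y)) + c * cnj c * ip y y"
      by (simp add: add_scale_left add_scale_right conj_sym[of y x] algebra_simps)
    also have "cnj c * ip x y + c * cnj (ip x y) = - 2 * of_real l * (ip x y * cnj (ip x y))"
      by (simp add: c_def algebra_simps)
    also have "c * cnj c = of_real l * of_real l * (ip x y * cnj (ip x y))"
      by (simp add: c_def algebra_simps)
    finally have "ip (\<lambda>i. x i + c * y i) (\<lambda>i. x i + c * y i) = 
        ip x x - of_real (2 * l * T) + of_real (l\<^sup>2 * T * Re (ip y y))"
      unfolding T by (subst (asm) (3) self_real) (simp add: power2_eq_square add.assoc)
    then show ?thesis
      using self_nonneg[of "\<lambda>i. x i + c * y i"] by simp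
  qed
  show ?thesis
  proof (cases "Re (ip y y) = 0")
    case True
    have "T = 0"
    proof (rule ccontr)
      assume "T \<noteq> 0"
      then have "T > 0" by (simp add: T_def)
      \<comment> \<open>For null \<open>y\<close> this \<open>l\<close> makes the affine bound negative.\<close>
      with expand[of "(Re (ip x x) + 1) / T"] True self_nonneg[of x] show False
        by simp
    qed
    then show ?thesis
      unfolding T_def[symmetric] using True by simp
  next
    case False
    then have pos: "Re (ip y y) > 0" using self_nonneg[of y] by simp
    have "0 \<le> Re (ip x x) - T / Re (ip y y)"
      using expand[of "1 / Re (ip y y)"] pos by (simp add: power2_eq_square field_simps)
    then show ?thesis
      using pos by (simp add: T_def[symmetric] field_simps)
  qed
qed

lemma null_orthogonal: "Re (ip y y) = 0 \<Longrightarrow> ip x y = 0"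
  using Cauchy_Schwarz[of x y] by simp

text \<open>
  The orthogonal projection of \<open>y\<close> onto the span of the \<open>q b\<close> is \<open>\<Sum>b<m. ip y (h b) * q b\<close>. The
  coefficients are given by inner products with fixed vectors, rather than just as some solution of
  the normal equations, because then Cauchy-Schwarz bounds them by the seminorm of \<open>y\<close>; the \<open>q b\<close> may be
  linearly dependent or null.

  The proof is Gram-Schmidt: split off the residual \<open>r\<close> of the new vector after projection onto the
  old ones. If \<open>r\<close> is null it is orthogonal to everything and needs no correction.
\<close>

theorem orthogonal_projection:
  fixes q :: "nat \<Rightarrow> 'i \<Rightarrow> complex"
  shows "\<exists>h. \<forall>y. \<forall>a<m. ip y (q a) = (\<Sum>b<m. ip y (h b) * ip (q b) (q a))"
proof (induction m)
  case (Suc m)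
  then obtain h where h: "\<And>y a. a < m \<Longrightarrow> ip y (q a) = (\<Sum>b<m. ip y (h b) * ip (q b) (q a))"
    by blast
  define d where "d b = ip (q m) (h b)" for b
  define r where "r = (\<lambda>i. q m i - (\<Sum>b<m. d b * q b i))"
  have r_orth: "ip r (q a) = 0" if "a < m" for a
    using h[OF that, of "q m"] by (simp add: r_def diff_left sum_left d_def)
  have q_r: "ip (q a) r = 0" if "a < m" for a
    using r_orth[OF that] conj_sym[of "q a" r] by simp
  define \<tau> where "\<tau> = (if Re (ip r r) = 0 then 0 else inverse (Re (ip r r)))"
  define h' where
    "h' b = (if b < m then (\<lambda>i. h b i + (- cnj (d b) * \<tau>) * r i) else (\<lambda>i. \<tau> * r i))" for b
  have h'_lt: "ip y (h' b) = ip y (h b) - d b * (\<tau> * ip y r)" if "b < m" for y b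
    using that add_scale_right[of y "h b" "- cnj (d b) * \<tau>" r] by (simp add: h'_def)
  have h'_m: "ip y (h' m) = \<tau> * ip y r" for y
    using add_scale_right[of y "\<lambda>i. 0" \<tau> r] sum_right[of y _ _ "{}"] by (simp add: h'_def)
  have "ip y (q a) = (\<Sum>b<Suc m. ip y (h' b) * ip (q b) (q a))" if a: "a < Suc m" for y a
  proof -
    have expand: "(\<Sum>b<Suc m. ip y (h' b) * ip (q b) (q a))
        = (\<Sum>b<m. ip y (h b) * ip (q b) (q a)) + \<tau> * ip y r * ip r (q a)"
    proof -
      have "ip r (q a) = ip (q m) (q a) - (\<Sum>b<m. d b * ip (q b) (q a))"
        by (simp add: r_def diff_left sum_left)
      then show ?thesis
        by (simp add: h'_lt h'_m sum_subtractf left_diff_distrib right_diff_distrib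
            sum_distrib_left mult_ac)
    qed
    show ?thesis
    proof (cases "a < m")
      case True
      then show ?thesis unfolding expand using h[OF True, of y] r_orth[OF True] by simp
    next
      case False
      with a have [simp]: "a = m" by simp
      have qm: "q m = (\<lambda>i. r i + (\<Sum>b<m. d b * q b i))"
        by (auto simp: r_def)
      have split: "ip y (q m) = ip y r + (\<Sum>b<m. cnj (d b) * ip y (q b))" for y
        by (subst qm) (simp add: add_right sum_right)
      have "(\<Sum>b<m. ip y (h b) * ip (q b) (q m))
          = (\<Sum>b<m. ip y (h b) * (\<Sum>b'<m. cnj (d b') * ip (q b) (q b')))"
        by (simp add: split q_r)
      also have "\<dots> = (\<Sum>b'<m. cnj (d b') * (\<Sum>b<m. ip y (h b) * ip (q b) (q b')))"
        unfolding sum_distrib_left by (subst sum.swap) (simp add: mult_ac)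
      also have "\<dots> = (\<Sum>b'<m. cnj (d b') * ip y (q b'))"
        by (simp add: h[symmetric])
      finally have 1: "(\<Sum>b<m. ip y (h b) * ip (q b) (q m)) = (\<Sum>b'<m. cnj (d b') * ip y (q b'))" .
      have "ip r (q m) = ip r r"
        by (simp add: split r_orth)
      moreover have "\<tau> * ip y r * ip r r = ip y r"
      proof (cases "Re (ip r r) = 0")
        case True
        then show ?thesis using null_orthogonal[of r y] by simp
      next
        case False
        then have "of_real \<tau> * ip r r = 1"
          by (subst self_real) (simp add: \<tau>_def)
        then show ?thesis by (simp add: mult_ac)
      qed
      ultimately have 2: "\<tau> * ip y r * ip r (q m) = ip y r" by simp
      show ?thesis unfolding expand using 1 2 split[of y] by simp
    qed
  qed
  then show ?case by blast
qed simp

text \<open>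
  The left-hand side is the square norm of the projection of \<open>y\<close>, so this is Pythagoras.
\<close>

lemma projection_contractive:
  assumes "\<And>a. a < m \<Longrightarrow> ip y (q a) = (\<Sum>b<m. c b * ip (q b) (q a))"
  shows "Re (\<Sum>a<m. \<Sum>b<m. c b * cnj (c a) * ip (q b) (q a)) \<le> Re (ip y y)"
proof -
  define p where "p = (\<lambda>i. \<Sum>b<m. c b * q b i)"
  define r where "r = (\<lambda>i. y i - p i)"
  have y: "y = (\<lambda>i. r i + p i)" by (simp add: r_def)
  have "ip r (q a) = 0" if "a < m" for a
    using assms[OF that] by (simp add: r_def diff_left p_def sum_left)
  then have rp: "ip r p = 0"
    by (simp add: p_def sum_right)
  then have "ip p r = 0" using conj_sym[of p r] by simp
  with rp have "ip y y = ip r r + ip p p"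
    by (subst (1 2) y) (simp add: add_left add_right)
  moreover have "ip p p = (\<Sum>a<m. \<Sum>b<m. c b * cnj (c a) * ip (q b) (q a))"
    unfolding p_def sum_right sum_left by (simp add: sum_distrib_left mult_ac)
  ultimately show ?thesis
    using self_nonneg[of r] by simp
qed

text \<open>
  With the triangle inequality for the seminorm, this is the scalar Cauchy-Schwarz inequality
  applied to \<open>\<beta> n * N (v n) = sqrt (\<beta> n * \<mu> n) * (sqrt (\<beta> n / \<mu> n) * N (v n))\<close>.
\<close>

lemma weighted_convexity:
  fixes \<beta> \<mu> :: "'n \<Rightarrow> real"
  assumes \<beta>: "\<And>n. n \<in> A \<Longrightarrow> 0 \<le> \<beta> n" and \<mu>: "\<And>n. n \<in> A \<Longrightarrow> 0 < \<mu> n"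
  shows "Re (ip (\<lambda>i. \<Sum>n\<in>A. of_real (\<beta> n) * v n i) (\<lambda>i. \<Sum>n\<in>A. of_real (\<beta> n) * v n i))
    \<le> (\<Sum>n\<in>A. \<beta> n * \<mu> n) * (\<Sum>n\<in>A. \<beta> n * Re (ip (v n) (v n)) / \<mu> n)"
proof -
  define S where "S = (\<lambda>i. \<Sum>n\<in>A. of_real (\<beta> n) * v n i)"
  define N where "N x = sqrt (Re (ip x x))" for x
  have N2: "(N x)\<^sup>2 = Re (ip x x)" for x
    by (simp add: N_def self_nonneg)
  have CS: "Re (ip x y) \<le> N x * N y" for x y
  proof -
    have "Re (ip x y) \<le> cmod (ip x y)" by (rule complex_Re_le_cmod)
    also have "\<dots> \<le> sqrt (Re (ip x x) * Re (ip y y))"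
      using Cauchy_Schwarz by (rule real_le_rsqrt)
    finally show ?thesis by (simp add: N_def real_sqrt_mult)
  qed
  have "(N S)\<^sup>2 = (\<Sum>n\<in>A. \<beta> n * Re (ip (v n) S))"
    unfolding N2 by (subst (1) S_def) (simp add: sum_left)
  also have "\<dots> \<le> (\<Sum>n\<in>A. \<beta> n * (N (v n) * N S))"
    by (intro sum_mono mult_left_mono CS \<beta>)
  also have "\<dots> = (\<Sum>n\<in>A. \<beta> n * N (v n)) * N S"
    by (simp add: sum_distrib_left mult_ac)
  finally have "N S * N S \<le> (\<Sum>n\<in>A. \<beta> n * N (v n)) * N S"
    by (simp add: power2_eq_square)
  then have "N S \<le> (\<Sum>n\<in>A. \<beta> n * N (v n)) \<or> N S \<le> 0"
    by (metis mult_le_cancel_right not_le)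
  moreover have "0 \<le> (\<Sum>n\<in>A. \<beta> n * N (v n))"
    by (intro sum_nonneg mult_nonneg_nonneg \<beta>) (simp_all add: N_def self_nonneg)
  ultimately have "N S \<le> (\<Sum>n\<in>A. \<beta> n * N (v n))" by auto
  then have "(N S)\<^sup>2 \<le> (\<Sum>n\<in>A. \<beta> n * N (v n))\<^sup>2"
    by (intro power_mono) (simp_all add: N_def self_nonneg)
  also have "(\<Sum>n\<in>A. \<beta> n * N (v n)) = (\<Sum>n\<in>A. sqrt (\<beta> n * \<mu> n) * (sqrt (\<beta> n / \<mu> n) * N (v n)))"
  proof (rule sum.cong[OF refl])
    fix n assume n: "n \<in> A"
    have "sqrt (\<beta> n * \<mu> n) * sqrt (\<beta> n / \<mu> n) = sqrt (\<beta> n * \<beta> n)"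
      using \<mu>[OF n] by (simp flip: real_sqrt_mult)
    then show "\<beta> n * N (v n) = sqrt (\<beta> n * \<mu> n) * (sqrt (\<beta> n / \<mu> n) * N (v n))"
      using \<beta>[OF n] by (simp flip: mult.assoc)
  qed
  also have "\<dots>\<^sup>2 \<le> (\<Sum>n\<in>A. (sqrt (\<beta> n * \<mu> n))\<^sup>2) * (\<Sum>n\<in>A. (sqrt (\<beta> n / \<mu> n) * N (v n))\<^sup>2)"
    by (rule Cauchy_Schwarz_ineq_sum)
  also have "(\<Sum>n\<in>A. (sqrt (\<beta> n * \<mu> n))\<^sup>2) = (\<Sum>n\<in>A. \<beta> n * \<mu> n)"
    using \<beta> \<mu> by (intro sum.cong) (auto simp: less_imp_le)
  also have "(\<Sum>n\<in>A. (sqrt (\<beta> n / \<mu> n) * N (v n))\<^sup>2) = (\<Sum>n\<in>A. \<beta> n * Re (ip (v n) (v n)) / \<mu> n)"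
    using \<beta> \<mu> by (intro sum.cong) (auto simp: power_mult_distrib N2 less_imp_le)
  finally show ?thesis
    unfolding N2 S_def .
qed

end

section \<open>Kaluza's lemma and renewal sequences\<close>

lemma renewal_coeff_le:
  fixes a b :: "nat \<Rightarrow> real"
  assumes "\<And>n. 0 \<le> b n" "\<And>n. 0 \<le> a n"
    and "a k = (\<Sum>n=1..k. b n * a (k - n))" "1 \<le> k"
  shows "b k * a 0 \<le> a k"
proof -
  have "b k * a (k - k) \<le> (\<Sum>n=1..k. b n * a (k - n))"
    by (rule member_le_sum[where f = "\<lambda>n. b n * a (k - n)"]) (use assms in auto)
  then show ?thesis using assms(3) by simp
qed

lemma norm_summable_bounded_coeffs:
  assumes "\<And>k. cmod (c k) \<le> B" "cmod w < 1"
  shows "summable (\<lambda>k. cmod (c k * w ^ k))"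
proof (rule summable_comparison_test'[where N = 0])
  show "summable (\<lambda>k. B * cmod w ^ k)"
    using assms(2) by (intro summable_mult summable_geometric) simp
  show "norm (cmod (c k * w ^ k)) \<le> B * cmod w ^ k" for k
    using assms(1)[of k] by (simp add: norm_mult norm_power mult_right_mono)
qed

text \<open>
  The coefficients of \<open>1 - 1 / A\<close>, where \<open>A\<close> is the power series with coefficients \<open>a\<close> and \<open>a 0 = 1\<close>.
\<close>

fun renewal_seq :: "(nat \<Rightarrow> real) \<Rightarrow> nat \<Rightarrow> real" where
  "renewal_seq a k = (if k = 0 then 0 else a k - (\<Sum>n<k. renewal_seq a n * a (k - n)))"

declare renewal_seq.simps [simp del]

lemma renewal_seq_0: "renewal_seq a 0 = 0"
  by (simp add: renewal_seq.simps)

lemma renewal_equation: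
  assumes "a 0 = 1" "1 \<le> k"
  shows "a k = (\<Sum>n=1..k. renewal_seq a n * a (k - n))"
proof -
  have "(\<Sum>n<k. renewal_seq a n * a (k - n)) = (\<Sum>n\<in>{1..<k}. renewal_seq a n * a (k - n))"
    by (rule sum.mono_neutral_right) (auto simp: renewal_seq_0 not_less_eq_eq)
  moreover have "{1..k} = insert k {1..<k}"
    using assms(2) by auto
  ultimately show ?thesis
    using assms renewal_seq.simps[of a k] by simp
qed

text \<open>
  The ratios \<open>\<rho> i = a (i + 1) / a i\<close> increase. Passing from time \<open>j\<close> to \<open>j + 1\<close> multiplies each
  \<open>a (j - n)\<close> in the renewal equation for \<open>a j\<close> by \<open>\<rho> (j - n) \<le> \<rho> j\<close>, so the terms up to \<open>n = j\<close> of the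
  equation at \<open>j + 1\<close> add up to at most \<open>\<rho> j * a j = a (j + 1)\<close>, and the last term makes up the
  difference.
\<close>

theorem Kaluza:
  assumes "a 0 = 1" and pos: "\<And>k. 0 < a k"
    and log_convex: "\<And>k. (a (Suc k))\<^sup>2 \<le> a k * a (Suc (Suc k))"
  shows "0 \<le> renewal_seq a k"
proof (induction k rule: less_induct)
  case (less k)
  define \<rho> where "\<rho> i = a (Suc i) / a i" for i
  have "incseq \<rho>"
  proof (rule incseq_SucI)
    show "\<rho> i \<le> \<rho> (Suc i)" for i
      using log_convex[of i] pos[of i] pos[of "Suc i"]
      by (simp add: \<rho>_def field_simps power2_eq_square)
  qed
  have step: "a (Suc i) = \<rho> i * a i" for i
    using pos[of i] by (simp add: \<rho>_def)
  consider "k = 0" | "k = 1" | j where "k = Suc j" "1 \<le> j"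
    by (cases k) (auto simp: Suc_le_eq)
  then show ?case
  proof cases
    case 1
    then show ?thesis by (simp add: renewal_seq_0)
  next
    case 2
    have "renewal_seq a 1 = a 1"
      by (subst renewal_seq.simps) (simp add: renewal_seq_0)
    then show ?thesis using 2 pos[of 1] by simp
  next
    case (3 j)
    have "(\<Sum>n<k. renewal_seq a n * a (k - n)) = (\<Sum>n\<in>{1..j}. renewal_seq a n * a (Suc (j - n)))"
    proof -
      have "(\<Sum>n<k. renewal_seq a n * a (k - n)) = (\<Sum>n\<in>{1..j}. renewal_seq a n * a (k - n))"
        unfolding 3(1)
        by (rule sum.mono_neutral_right) (auto simp: renewal_seq_0 not_less_eq_eq)
      then show ?thesis
        using 3(1) by (simp add: Suc_diff_le)
    qed
    also have "\<dots> \<le> (\<Sum>n\<in>{1..j}. renewal_seq a n * (\<rho> j * a (j - n)))"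
      unfolding step using 3(1) incseqD[OF \<open>incseq \<rho>\<close>]
      by (intro sum_mono mult_left_mono mult_right_mono less.IH)
         (auto intro: less_imp_le pos)
    also have "\<dots> = \<rho> j * (\<Sum>n=1..j. renewal_seq a n * a (j - n))"
      by (simp add: sum_distrib_left mult_ac)
    also have "\<dots> = a k"
      using renewal_equation[of a j] assms(1) 3 step[of j] by simp
    finally show ?thesis
      by (subst renewal_seq.simps) simp
  qed
qed

text \<open>
  By the renewal equation the Cauchy product of the two series is the series of \<open>a\<close> without its
  constant term.
\<close>

lemma renewal_generating_function:
  fixes x :: complex
  assumes "a 0 = 1" and a: "\<And>k. \<bar>a k\<bar> \<le> 1" and b: "\<And>k. \<bar>renewal_seq a k\<bar> \<le> 1" and x: "cmod x < 1"
  shows "(\<Sum>n. of_real (a n) * x ^ n) * (1 - (\<Sum>n. of_real (renewal_seq a n) * x ^ n)) = 1"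
proof -
  let ?b = "renewal_seq a"
  have A: "summable (\<lambda>k. cmod (of_real (a k) * x ^ k))"
    by (rule norm_summable_bounded_coeffs[where B = 1]) (use a x in auto)
  have B: "summable (\<lambda>k. cmod (of_real (?b k) * x ^ k))"
    by (rule norm_summable_bounded_coeffs[where B = 1]) (use b x in auto)
  have "(\<lambda>k. \<Sum>n\<le>k. (of_real (?b n) * x ^ n) * (of_real (a (k - n)) * x ^ (k - n)))
      sums ((\<Sum>n. of_real (?b n) * x ^ n) * (\<Sum>n. of_real (a n) * x ^ n))"
    by (rule Cauchy_product_sums[OF B A])
  also have "(\<lambda>k. \<Sum>n\<le>k. (of_real (?b n) * x ^ n) * (of_real (a (k - n)) * x ^ (k - n)))
      = (\<lambda>k. of_real (a k) * x ^ k - (if k = 0 then 1 else 0))"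
  proof
    fix k
    have "(\<Sum>n\<le>k. (of_real (?b n) * x ^ n) * (of_real (a (k - n)) * x ^ (k - n)))
        = (\<Sum>n\<le>k. of_real (?b n * a (k - n)) * x ^ k)"
    proof (intro sum.cong refl)
      fix n assume "n \<in> {..k}"
      then have "x ^ k = x ^ n * x ^ (k - n)"
        by (simp flip: power_add)
      then show "(of_real (?b n) * x ^ n) * (of_real (a (k - n)) * x ^ (k - n))
          = of_real (?b n * a (k - n)) * x ^ k"
        by (simp only: of_real_mult mult_ac)
    qed
    also have "\<dots> = of_real (\<Sum>n\<le>k. ?b n * a (k - n)) * x ^ k"
      by (simp add: sum_distrib_right)
    also have "(\<Sum>n\<le>k. ?b n * a (k - n)) = (\<Sum>n=1..k. ?b n * a (k - n))"
      by (rule sum.mono_neutral_right) (auto simp: renewal_seq_0 not_less_eq_eq)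
    also have "\<dots> = (if k = 0 then 0 else a k)"
      using renewal_equation[of a k] assms(1) by simp
    finally show "(\<Sum>n\<le>k. (of_real (?b n) * x ^ n) * (of_real (a (k - n)) * x ^ (k - n)))
        = of_real (a k) * x ^ k - (if k = 0 then 1 else 0)"
      using assms(1) by (simp split: if_splits)
  qed
  finally have "(\<lambda>k. of_real (a k) * x ^ k - (if k = 0 then 1 else 0))
      sums ((\<Sum>n. of_real (?b n) * x ^ n) * (\<Sum>n. of_real (a n) * x ^ n))" .
  moreover have "(\<lambda>k. of_real (a k) * x ^ k - (if k = 0 then 1 else 0))
      sums ((\<Sum>n. of_real (a n) * x ^ n) - 1)"
    using sums_diff[OF summable_sums[OF summable_norm_cancel[OF A]] sums_single[of 0 "\<lambda>_. 1"]] by simp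
  ultimately show ?thesis
    using sums_unique2 by (fastforce simp: algebra_simps)
qed

lemma fps_conv_radius_bounded_coeffs:
  fixes f :: "complex fps"
  assumes "\<And>k. cmod (fps_nth f k) \<le> B"
  shows "1 \<le> fps_conv_radius f"
  unfolding fps_conv_radius_def
proof (rule conv_radius_geI_ex')
  fix r :: real
  assume "0 < r" "ereal r < 1"
  then have "cmod (of_real r) < 1" by simp
  from norm_summable_bounded_coeffs[OF assms this]
  show "summable (\<lambda>n. fps_nth f n * of_real r ^ n)"
    by (rule summable_norm_cancel)
qed

section \<open>Realisation of an interpolating transfer function\<close>

text \<open>
  Coefficients of the solution of a linear system of power series in which every loop has a delay of
  at least one, so that coefficient \<open>k\<close> is determined by the coefficients below \<open>k\<close>.
\<close>

fun feedback_coeff ::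
  "nat \<Rightarrow> (nat \<Rightarrow> complex) \<Rightarrow> (nat \<Rightarrow> nat \<Rightarrow> complex) \<Rightarrow> (nat \<Rightarrow> complex fps) \<Rightarrow> nat \<Rightarrow> nat \<Rightarrow> complex"
where
  "feedback_coeff m \<rho> R l k b =
     (if k = 0 then \<rho> b else 0) +
     (\<Sum>q<m. R q b * (\<Sum>n<k. fps_nth (l q) (k - n) * feedback_coeff m \<rho> R l n q))"

declare feedback_coeff.simps [simp del]

lemma feedback_system_solvable:
  fixes l :: "nat \<Rightarrow> complex fps"
  assumes "\<And>q. fps_nth (l q) 0 = 0"
  shows "\<exists>H. \<forall>b. H b = fps_const (\<rho> b) + (\<Sum>q<m. fps_const (R q b) * (l q * H q))"
proof (intro exI allI)
  fix b
  let ?H = "\<lambda>b. Abs_fps (\<lambda>k. feedback_coeff m \<rho> R l k b)"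
  have conv: "fps_nth (l q * ?H q) k
      = (\<Sum>n<k. fps_nth (l q) (k - n) * feedback_coeff m \<rho> R l n q)" for q k
  proof -
    have "fps_nth (l q * ?H q) k
        = (\<Sum>n=0..k. fps_nth (l q) (k - n) * feedback_coeff m \<rho> R l n q)"
      unfolding mult.commute[of "l q"] fps_mult_nth by (simp add: mult.commute)
    also have "{0..k} = insert k {..<k}" by auto
    finally show ?thesis by (simp add: assms)
  qed
  show "?H b = fps_const (\<rho> b) + (\<Sum>q<m. fps_const (R q b) * (l q * ?H q))"
  proof (rule fps_ext)
    fix k
    show "fps_nth (?H b) k
        = fps_nth (fps_const (\<rho> b) + (\<Sum>q<m. fps_const (R q b) * (l q * ?H q))) k"
      by (simp add: fps_sum_nth conv feedback_coeff.simps[of m \<rho> R l k b])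
  qed
qed

text \<open>
  The setting: \<open>P\<close> is a Pick matrix of size \<open>m\<close>; its index \<open>p\<close> stands for the node \<open>z p\<close> together with the
  number \<open>\<iota> p < s\<close> of a row of the target matrix at that node, and \<open>W p\<close> is that row, of length \<open>t\<close>.
  The weights \<open>\<omega> k\<close> are the squared norms of the monomials. The last assumption is the Pick matrix
  identity after division by the kernel.
\<close>

locale pick_data =
  fixes \<omega> b :: "nat \<Rightarrow> real" and m s t :: nat and z :: "nat \<Rightarrow> complex" and \<iota> :: "nat \<Rightarrow> nat"
    and W P :: "nat \<Rightarrow> nat \<Rightarrow> complex"
  assumes weight_ge_1: "\<And>k. 1 \<le> \<omega> k"
    and b_nonneg: "\<And>n. 0 \<le> b n" and b_0: "b 0 = 0"
    and renewal: "\<And>k. 1 \<le> k \<Longrightarrow> 1 / \<omega> k = (\<Sum>n=1..k. b n / \<omega> (k - n))"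
    and z_disc: "\<And>p. p < m \<Longrightarrow> cmod (z p) < 1"
    and row_less: "\<And>p. p < m \<Longrightarrow> \<iota> p < s"
    and P_herm: "\<And>p q. p < m \<Longrightarrow> q < m \<Longrightarrow> P q p = cnj (P p q)"
    and P_psd: "\<And>x. 0 \<le> Re (\<Sum>p<m. \<Sum>q<m. P p q * x q * cnj (x p))"
    and P_eq: "\<And>p q. p < m \<Longrightarrow> q < m \<Longrightarrow>
      P p q * (1 - (\<Sum>n. of_real (b n) * (z p * cnj (z q)) ^ n))
        = (if \<iota> p = \<iota> q then 1 else 0) - (\<Sum>j<t. W p j * cnj (W q j))"
begin

lemma weight_pos: "0 < \<omega> k"
  using weight_ge_1[of k] by simp

lemma b_bounded: "b n \<le> \<omega> 0"
proof (cases "n = 0")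
  case True
  then show ?thesis using b_0 weight_pos[of 0] by simp
next
  case False
  have "b n * (1 / \<omega> 0) \<le> 1 / \<omega> n"
    by (rule renewal_coeff_le[where a = "\<lambda>n. 1 / \<omega> n"])
       (use False renewal[of n] b_nonneg weight_pos in \<open>auto simp: less_imp_le\<close>)
  also have "\<dots> \<le> 1" using weight_ge_1[of n] by simp
  finally show ?thesis using weight_pos[of 0] by (simp add: field_simps)
qed

definition L :: "nat \<Rightarrow> nat \<Rightarrow> complex" where
  "L p q = (\<Sum>n. of_real (b n) * (z p * cnj (z q)) ^ n)"

lemma L_norm_summable:
  assumes "p < m" "q < m"
  shows "summable (\<lambda>n. cmod (of_real (b n) * cnj (z q) ^ n * z p ^ n))"
proof -
  have "cmod (z p) * cmod (z q) < 1"
    using mult_strict_mono[OF z_disc[OF assms(1)] z_disc[OF assms(2)]] by simp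
  then have "summable (\<lambda>n. cmod (of_real (b n) * (z p * cnj (z q)) ^ n))"
    by (intro norm_summable_bounded_coeffs[where B = "\<omega> 0"])
       (use b_nonneg b_bounded in \<open>auto simp: norm_mult\<close>)
  then show ?thesis
    by (simp add: power_mult_distrib mult_ac)
qed

lemma L_sums:
  assumes "p < m" "q < m"
  shows "(\<lambda>n. of_real (b n) * (z p * cnj (z q)) ^ n) sums L p q"
  using summable_norm_cancel[OF L_norm_summable[OF assms]]
  unfolding L_def by (simp add: power_mult_distrib mult_ac summable_sums)

definition state_ip :: "(nat \<Rightarrow> complex) \<Rightarrow> (nat \<Rightarrow> complex) \<Rightarrow> complex" where
  "state_ip x y = (\<Sum>p<m. \<Sum>q<m. P p q * x q * cnj (y p))"

text \<open>
  An (input, state) vector is a single function: the arguments below \<open>t\<close> carry the input and \<open>t + p\<close>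
  carries coordinate \<open>p\<close> of the state. The state space is \<open>\<complex>\<^sup>m\<close> with Gram matrix \<open>P\<close>, which spares a
  factorisation of \<open>P\<close> at the price of null vectors.
\<close>

definition ip :: "(nat \<Rightarrow> complex) \<Rightarrow> (nat \<Rightarrow> complex) \<Rightarrow> complex" where
  "ip u v = (\<Sum>j<t. u j * cnj (v j)) + state_ip (\<lambda>p. u (t + p)) (\<lambda>p. v (t + p))"

sublocale state: semi_inner state_ip
proof
  show "state_ip (\<lambda>i. x i + c * y i) w = state_ip x w + c * state_ip y w" for x y c w
    by (simp add: state_ip_def distrib_left distrib_right sum.distrib sum_distrib_left mult_ac)
  show "state_ip y x = cnj (state_ip x y)" for x y
  proof -
    have "cnj (state_ip x y) = (\<Sum>p<m. \<Sum>q<m. P q p * cnj (x q) * y p)"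
      unfolding state_ip_def cnj_sum by (intro sum.cong refl) (simp add: P_herm[symmetric])
    also have "\<dots> = state_ip y x"
      unfolding state_ip_def by (subst sum.swap) (simp add: mult_ac)
    finally show ?thesis ..
  qed
  show "0 \<le> Re (state_ip x x)" for x
    unfolding state_ip_def by (rule P_psd)
qed

sublocale semi_inner ip
proof
  show "ip (\<lambda>i. x i + c * y i) w = ip x w + c * ip y w" for x y c w
    by (simp add: ip_def state.add_scale_left distrib_left distrib_right sum.distrib sum_distrib_left mult_ac)
  show "ip y x = cnj (ip x y)" for x y
    using state.conj_sym[of "\<lambda>p. y (t + p)" "\<lambda>p. x (t + p)"] by (simp add: ip_def mult.commute)
  show "0 \<le> Re (ip x x)" for x
    unfolding ip_def using state.self_nonneg by (simp add: sum_nonneg)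
qed

definition row_vec :: "nat \<Rightarrow> nat \<Rightarrow> complex" where
  "row_vec a = (\<lambda>i. if i < t then cnj (W a i) else if i = t + a then 1 else 0)"

lemma ip_row_vec:
  assumes "a < m"
  shows "ip u (row_vec a) = (\<Sum>j<t. u j * W a j) + (\<Sum>q<m. P a q * u (t + q))"
proof -
  have "state_ip (\<lambda>p. u (t + p)) (\<lambda>p. row_vec a (t + p))
      = (\<Sum>p<m. if p = a then \<Sum>q<m. P p q * u (t + q) else 0)"
    unfolding state_ip_def by (intro sum.cong refl) (auto simp: row_vec_def)
  also have "\<dots> = (\<Sum>q<m. P a q * u (t + q))"
    using assms by simp
  finally show ?thesis
    by (simp add: ip_def row_vec_def)
qed

text \<open>
  This is the equality of Gram matrices behind the lurking isometry: the right-hand side is the Gram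
  matrix of the corresponding (output, branches) vectors.
\<close>

lemma gram_row_vec:
  assumes "a < m" "c < m"
  shows "ip (row_vec c) (row_vec a) = (if \<iota> a = \<iota> c then 1 else 0) + P a c * L a c"
proof -
  have "(\<Sum>q<m. P a q * row_vec c (t + q)) = (\<Sum>q<m. if q = c then P a q else 0)"
    by (intro sum.cong refl) (auto simp: row_vec_def)
  then have "ip (row_vec c) (row_vec a) = (\<Sum>j<t. W a j * cnj (W c j)) + P a c"
    using assms by (simp add: ip_row_vec) (simp add: row_vec_def mult.commute)
  then show ?thesis
    using P_eq[OF assms] unfolding L_def[symmetric] by (simp add: algebra_simps)
qed

text \<open>
  The inner products with these vectors are the coefficients of the orthogonal projection onto the
  span of the \<open>row_vec c\<close>.
\<close>

definition dual_vec :: "nat \<Rightarrow> nat \<Rightarrow> complex" where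
  "dual_vec = (SOME h. \<forall>y. \<forall>a<m.
     ip y (row_vec a) = (\<Sum>c<m. ip y (h c) * ip (row_vec c) (row_vec a)))"

lemma dual_vec:
  "a < m \<Longrightarrow> ip y (row_vec a) = (\<Sum>c<m. ip y (dual_vec c) * ip (row_vec c) (row_vec a))"
  unfolding dual_vec_def by (rule someI_ex[OF orthogonal_projection, rule_format])

text \<open>
  Delay \<open>n\<close> contributes the gain \<open>b n\<close>, and coordinate \<open>q\<close> of the state acquires the factor
  \<open>cnj (z q) ^ n\<close> in branch \<open>n\<close>. At a node \<open>z p\<close> this series has the value \<open>L p q\<close>.
\<close>

definition feedback :: "nat \<Rightarrow> complex fps" where
  "feedback q = Abs_fps (\<lambda>n. of_real (b n) * cnj (z q) ^ n)"

definition gain :: "nat \<Rightarrow> nat \<Rightarrow> complex" where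
  "gain q c = (\<Sum>p<m. P p q * cnj (dual_vec c (t + p)))"

lemma ip_dual_vec:
  "ip u (dual_vec c) = (\<Sum>j<t. u j * cnj (dual_vec c j)) + (\<Sum>q<m. gain q c * u (t + q))"
proof -
  have "state_ip (\<lambda>p. u (t + p)) (\<lambda>p. dual_vec c (t + p)) = (\<Sum>q<m. gain q c * u (t + q))"
    unfolding state_ip_def by (subst sum.swap) (simp add: gain_def sum_distrib_left sum_distrib_right mult_ac)
  then show ?thesis by (simp add: ip_def)
qed

text \<open>
  The projection coefficients of the system when a unit impulse arrives in input channel \<open>j\<close> at time
  \<open>0\<close>: they depend on the state, which is fed back from them.
\<close>

definition response :: "nat \<Rightarrow> nat \<Rightarrow> complex fps" where
  "response j = (SOME H. \<forall>c. H c = fps_const (cnj (dual_vec c j))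
     + (\<Sum>q<m. fps_const (gain q c) * (feedback q * H q)))"

lemma response_eq:
  "response j c = fps_const (cnj (dual_vec c j))
     + (\<Sum>q<m. fps_const (gain q c) * (feedback q * response j q))"
proof -
  have "\<exists>H. \<forall>c. H c = fps_const (cnj (dual_vec c j))
     + (\<Sum>q<m. fps_const (gain q c) * (feedback q * H q))"
    by (rule feedback_system_solvable) (simp add: feedback_def b_0)
  from someI_ex[OF this] show ?thesis
    unfolding response_def by blast
qed

definition transfer :: "nat \<Rightarrow> nat \<Rightarrow> complex fps" where
  "transfer i j = (\<Sum>c<m. if \<iota> c = i then response j c else 0)"

text \<open>
  The system driven by an arbitrary input \<open>F\<close>, whose channel \<open>j\<close> has coefficients \<open>F j\<close>. All its series
  are defined by convolution with the impulse responses; that they solve the driven system follows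
  from the impulse equations by linearity.
\<close>

context
  fixes F :: "nat \<Rightarrow> complex fps"
begin

definition proj_coeff :: "nat \<Rightarrow> complex fps" where
  "proj_coeff c = (\<Sum>j<t. response j c * F j)"

definition state_series :: "nat \<Rightarrow> complex fps" where
  "state_series q = feedback q * proj_coeff q"

definition out_series :: "nat \<Rightarrow> complex fps" where
  "out_series i = (\<Sum>j<t. transfer i j * F j)"

definition signal :: "nat \<Rightarrow> nat \<Rightarrow> complex" where
  "signal k i = (if i < t then fps_nth (F i) k else fps_nth (state_series (i - t)) k)"

lemma output_eq: "out_series i = (\<Sum>c<m. if \<iota> c = i then proj_coeff c else 0)"
proof -
  have "out_series i = (\<Sum>j<t. \<Sum>c<m. if \<iota> c = i then response j c * F j else 0)"
    unfolding out_series_def transfer_def sum_distrib_right by (intro sum.cong refl) auto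
  also have "\<dots> = (\<Sum>c<m. if \<iota> c = i then proj_coeff c else 0)"
    by (subst sum.swap) (auto simp: proj_coeff_def intro!: sum.cong)
  finally show ?thesis .
qed

lemma proj_coeff_eq:
  "proj_coeff c = (\<Sum>j<t. F j * fps_const (cnj (dual_vec c j)))
     + (\<Sum>q<m. fps_const (gain q c) * state_series q)"
proof -
  have "proj_coeff c = (\<Sum>j<t. F j * fps_const (cnj (dual_vec c j))
      + (\<Sum>q<m. fps_const (gain q c) * (feedback q * (response j q * F j))))"
    unfolding proj_coeff_def
    by (intro sum.cong refl, subst response_eq)
       (simp add: distrib_left sum_distrib_left mult_ac)
  also have "\<dots> = (\<Sum>j<t. F j * fps_const (cnj (dual_vec c j)))
      + (\<Sum>q<m. fps_const (gain q c) * (\<Sum>j<t. feedback q * (response j q * F j)))"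
    by (simp only: sum.distrib sum_distrib_left) (subst sum.swap, rule refl)
  also have "(\<Sum>q<m. fps_const (gain q c) * (\<Sum>j<t. feedback q * (response j q * F j)))
      = (\<Sum>q<m. fps_const (gain q c) * state_series q)"
    by (simp only: state_series_def proj_coeff_def sum_distrib_left)
  finally show ?thesis .
qed

text \<open>
  The driven system is closed: at each time the projection coefficients are those of the current
  (input, state) vector.
\<close>

lemma proj_coeff_nth: "fps_nth (proj_coeff c) k = ip (signal k) (dual_vec c)"
  by (subst proj_coeff_eq) (simp add: ip_dual_vec signal_def fps_sum_nth)

lemma signal_projection:
  assumes "a < m"
  shows "ip (signal k) (row_vec a)
    = (\<Sum>c<m. fps_nth (proj_coeff c) k * ip (row_vec c) (row_vec a))"
  unfolding proj_coeff_nth by (rule dual_vec[OF assms])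

text \<open>
  The output differs from the interpolation value \<open>W a\<close> applied to the input only by terms that have
  zero sum at \<open>z a\<close>, where \<open>state_series q\<close> equals \<open>L a q\<close> times \<open>proj_coeff q\<close>.
\<close>

lemma output_nth:
  assumes "a < m"
  shows "fps_nth (out_series (\<iota> a)) k
    = (\<Sum>j<t. W a j * fps_nth (F j) k)
      + (\<Sum>q<m. P a q * (fps_nth (state_series q) k - L a q * fps_nth (proj_coeff q) k))"
proof -
  have "(\<Sum>c<m. fps_nth (proj_coeff c) k * ip (row_vec c) (row_vec a))
      = (\<Sum>c<m. (if \<iota> c = \<iota> a then fps_nth (proj_coeff c) k else 0)
          + P a c * (L a c * fps_nth (proj_coeff c) k))"
    using assms by (intro sum.cong refl) (auto simp: gram_row_vec algebra_simps)
  also have "\<dots> = fps_nth (out_series (\<iota> a)) k + (\<Sum>c<m. P a c * (L a c * fps_nth (proj_coeff c) k))"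
    by (simp add: output_eq sum.distrib fps_sum_nth if_distrib[of "\<lambda>f. fps_nth f k"] cong: if_cong)
  finally have "(\<Sum>j<t. W a j * fps_nth (F j) k) + (\<Sum>q<m. P a q * fps_nth (state_series q) k)
      = fps_nth (out_series (\<iota> a)) k + (\<Sum>c<m. P a c * (L a c * fps_nth (proj_coeff c) k))"
    unfolding signal_projection[OF assms, of k, symmetric]
    using assms by (simp add: ip_row_vec signal_def mult.commute[of _ "W _ _"])
  then show ?thesis
    by (simp add: right_diff_distrib sum_subtractf eq_diff_eq add_diff_eq)
qed

text \<open>
  The state component of branch \<open>n\<close> at time \<open>k\<close>, without the factor \<open>\<surd>(b n)\<close>.
\<close>

definition branch :: "nat \<Rightarrow> nat \<Rightarrow> nat \<Rightarrow> complex" where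
  "branch n k = (\<lambda>p. cnj (z p) ^ n * fps_nth (proj_coeff p) k)"

definition branch_energy :: "nat \<Rightarrow> nat \<Rightarrow> real" where
  "branch_energy n k = Re (state_ip (branch n k) (branch n k))"

definition state_energy :: "nat \<Rightarrow> real" where
  "state_energy k = Re (state_ip (\<lambda>q. fps_nth (state_series q) k) (\<lambda>q. fps_nth (state_series q) k))"

lemma signal_energy: "Re (ip (signal k) (signal k)) = (\<Sum>j<t. (cmod (fps_nth (F j) k))\<^sup>2) + state_energy k"
proof -
  have "(\<Sum>j<t. signal k j * cnj (signal k j)) = of_real (\<Sum>j<t. (cmod (fps_nth (F j) k))\<^sup>2)"
    unfolding of_real_sum complex_norm_square by (intro sum.cong) (auto simp: signal_def)
  then show ?thesis
    by (simp add: ip_def state_energy_def signal_def)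
qed

lemma output_square_sum:
  "(\<Sum>a<m. \<Sum>c<m. fps_nth (proj_coeff c) k * cnj (fps_nth (proj_coeff a) k)
      * (if \<iota> a = \<iota> c then 1 else 0))
   = of_real (\<Sum>i<s. (cmod (fps_nth (out_series i) k))\<^sup>2)"
proof -
  define y where "y c = fps_nth (proj_coeff c) k" for c
  have out: "fps_nth (out_series i) k = (\<Sum>c<m. if \<iota> c = i then y c else 0)" for i
    by (simp add: output_eq fps_sum_nth if_distrib[of "\<lambda>f. fps_nth f k"] y_def cong: if_cong)
  have "of_real (\<Sum>i<s. (cmod (fps_nth (out_series i) k))\<^sup>2)
      = (\<Sum>i<s. \<Sum>a<m. \<Sum>c<m. (if \<iota> a = i then if \<iota> c = i then y c * cnj (y a) else 0 else 0))"
    unfolding of_real_sum complex_norm_square out cnj_sum sum_distrib_left sum_distrib_right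
    by (intro sum.cong refl) auto
  also have "\<dots> = (\<Sum>a<m. \<Sum>c<m. \<Sum>i<s. (if \<iota> a = i then if \<iota> c = i then y c * cnj (y a) else 0 else 0))"
    by (rule trans[OF sum.swap]) (rule sum.cong[OF refl], rule sum.swap)
  also have "\<dots> = (\<Sum>a<m. \<Sum>c<m. y c * cnj (y a) * (if \<iota> a = \<iota> c then 1 else 0))"
    using row_less by (intro sum.cong refl) auto
  finally show ?thesis by (simp add: y_def)
qed

text \<open>
  Contractivity of the lurking isometry at a single time. The square norm of the projected signal is
  computed from \<open>gram_row_vec\<close>: the Kronecker part gives the output energy, and expanding \<open>L\<close> in
  powers gives the branch energies. All terms are nonnegative, so the branches can be cut off at \<open>M\<close>.
\<close>

lemma output_plus_branch_energy_le:
  "(\<Sum>i<s. (cmod (fps_nth (out_series i) k))\<^sup>2) + (\<Sum>n<M. b n * branch_energy n k)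
    \<le> (\<Sum>j<t. (cmod (fps_nth (F j) k))\<^sup>2) + state_energy k"
proof -
  define y where "y c = fps_nth (proj_coeff c) k" for c
  have "Re (\<Sum>a<m. \<Sum>c<m. y c * cnj (y a) * ip (row_vec c) (row_vec a)) \<le> Re (ip (signal k) (signal k))"
    unfolding y_def by (rule projection_contractive) (rule signal_projection)
  also have "(\<Sum>a<m. \<Sum>c<m. y c * cnj (y a) * ip (row_vec c) (row_vec a))
      = (\<Sum>a<m. \<Sum>c<m. y c * cnj (y a) * (if \<iota> a = \<iota> c then 1 else 0))
        + (\<Sum>a<m. \<Sum>c<m. P a c * y c * cnj (y a) * L a c)"
    unfolding sum.distrib[symmetric]
    by (intro sum.cong refl) (simp add: gram_row_vec algebra_simps)
  also have "(\<Sum>a<m. \<Sum>c<m. y c * cnj (y a) * (if \<iota> a = \<iota> c then 1 else 0))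
      = of_real (\<Sum>i<s. (cmod (fps_nth (out_series i) k))\<^sup>2)"
    unfolding y_def by (rule output_square_sum)
  finally have le: "(\<Sum>i<s. (cmod (fps_nth (out_series i) k))\<^sup>2) + Re (\<Sum>a<m. \<Sum>c<m. P a c * y c * cnj (y a) * L a c)
      \<le> (\<Sum>j<t. (cmod (fps_nth (F j) k))\<^sup>2) + state_energy k"
    by (simp add: signal_energy)
  have "(\<lambda>n. \<Sum>a<m. \<Sum>c<m. P a c * y c * cnj (y a) * (of_real (b n) * (z a * cnj (z c)) ^ n))
      sums (\<Sum>a<m. \<Sum>c<m. P a c * y c * cnj (y a) * L a c)"
    by (intro sums_sum sums_mult L_sums) auto
  also have "(\<lambda>n. \<Sum>a<m. \<Sum>c<m. P a c * y c * cnj (y a) * (of_real (b n) * (z a * cnj (z c)) ^ n))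
      = (\<lambda>n. of_real (b n) * state_ip (branch n k) (branch n k))"
    unfolding state_ip_def branch_def sum_distrib_left y_def
    by (intro ext sum.cong refl) (simp add: power_mult_distrib)
  finally have "(\<lambda>n. Re (of_real (b n) * state_ip (branch n k) (branch n k)))
      sums Re (\<Sum>a<m. \<Sum>c<m. P a c * y c * cnj (y a) * L a c)"
    by (rule sums_Re)
  then have sm: "(\<lambda>n. b n * branch_energy n k) sums Re (\<Sum>a<m. \<Sum>c<m. P a c * y c * cnj (y a) * L a c)"
    by (simp add: branch_energy_def)
  have "(\<Sum>n<M. b n * branch_energy n k) \<le> Re (\<Sum>a<m. \<Sum>c<m. P a c * y c * cnj (y a) * L a c)"
    unfolding sums_unique[OF sm]
    by (rule sum_le_suminf[OF sums_summable[OF sm]])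
       (simp_all add: b_nonneg branch_energy_def state.self_nonneg)
  with le show ?thesis by simp
qed

text \<open>
  The state at time \<open>k\<close> is \<open>\<Sum>n=1..k. b n * branch n (k - n)\<close>. In \<open>weighted_convexity\<close> with
  \<open>\<mu> n = 1 / \<omega> (k - n)\<close> the first factor becomes \<open>1 / \<omega> k\<close> by the renewal equation. In terms of
  function spaces: multiplication by the row \<open>(\<surd>(b n) z\<^sup>n)\<close> is a contraction.
\<close>

lemma weighted_state_energy_le:
  "\<omega> k * state_energy k \<le> (\<Sum>n\<le>k. b n * (\<omega> (k - n) * branch_energy n (k - n)))"
proof -
  have series: "fps_nth (state_series q) k = (\<Sum>n=1..k. of_real (b n) * branch n (k - n) q)" for q
  proof -
    have "fps_nth (state_series q) k = (\<Sum>n=0..k. of_real (b n) * branch n (k - n) q)"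
      unfolding state_series_def fps_mult_nth by (simp add: feedback_def branch_def mult.assoc)
    also have "\<dots> = (\<Sum>n=1..k. of_real (b n) * branch n (k - n) q)"
      by (rule sum.mono_neutral_right) (auto simp: b_0 not_less_eq_eq)
    finally show ?thesis .
  qed
  have drop0: "(\<Sum>n=1..k. b n * (\<omega> (k - n) * branch_energy n (k - n)))
      = (\<Sum>n\<le>k. b n * (\<omega> (k - n) * branch_energy n (k - n)))"
    by (rule sum.mono_neutral_left) (auto simp: b_0 not_less_eq_eq)
  have "state_energy k \<le> (\<Sum>n=1..k. b n * (1 / \<omega> (k - n)))
      * (\<Sum>n=1..k. b n * branch_energy n (k - n) / (1 / \<omega> (k - n)))"
    unfolding state_energy_def series branch_energy_def
    by (rule state.weighted_convexity) (simp_all add: b_nonneg weight_pos)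
  also have "(\<Sum>n=1..k. b n * branch_energy n (k - n) / (1 / \<omega> (k - n)))
      = (\<Sum>n\<le>k. b n * (\<omega> (k - n) * branch_energy n (k - n)))"
    unfolding drop0[symmetric] by (simp add: mult_ac)
  finally have le: "state_energy k \<le> (\<Sum>n=1..k. b n * (1 / \<omega> (k - n)))
      * (\<Sum>n\<le>k. b n * (\<omega> (k - n) * branch_energy n (k - n)))" .
  show ?thesis
  proof (cases "k = 0")
    case True
    with le show ?thesis using b_0 weight_pos[of 0] by (simp add: mult_le_0_iff)
  next
    case False
    then have "(\<Sum>n=1..k. b n * (1 / \<omega> (k - n))) = 1 / \<omega> k"
      using renewal[of k] by simp
    with le have "state_energy k
        \<le> (\<Sum>n\<le>k. b n * (\<omega> (k - n) * branch_energy n (k - n))) / \<omega> k"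
      by (simp only: times_divide_eq_left mult_1_left)
    then show ?thesis
      by (simp only: pos_le_divide_eq[OF weight_pos] mult.commute[of "\<omega> k"])
  qed
qed

text \<open>
  Sum \<open>weighted_state_energy_le\<close> over \<open>k \<le> M\<close> and collect the branches by their starting time
  \<open>l = k - n\<close>. As every delay is positive, only times \<open>l < M\<close> occur, and
  \<open>output_plus_branch_energy_le\<close> bounds their branches. The state energies below \<open>M\<close> then cancel.
\<close>

theorem energy_inequality:
  "(\<Sum>k<M. \<omega> k * (\<Sum>i<s. (cmod (fps_nth (out_series i) k))\<^sup>2)) + \<omega> M * state_energy M
    \<le> (\<Sum>k<M. \<omega> k * (\<Sum>j<t. (cmod (fps_nth (F j) k))\<^sup>2))"
proof -
  define f where "f n l = b n * (\<omega> l * branch_energy n l)" for n l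
  have f_nonneg: "0 \<le> f n l" for n l
    using b_nonneg weight_pos[of l] by (simp add: f_def branch_energy_def state.self_nonneg)
  have "(\<Sum>k<Suc M. \<omega> k * state_energy k) \<le> (\<Sum>k<Suc M. \<Sum>n\<le>k. f n (k - n))"
    unfolding f_def by (intro sum_mono weighted_state_energy_le)
  also have "\<dots> = (\<Sum>(n, l)\<in>{(n, l). n + l < Suc M}. f n l)"
    by (rule sum.triangle_reindex[symmetric])
  \<comment> \<open>Discarding the delay \<open>n = 0\<close> is what restricts the starting times to \<open>l < M\<close>.\<close>
  also have "\<dots> = (\<Sum>(n, l)\<in>{(n, l). n \<noteq> 0 \<and> n + l < Suc M}. f n l)"
  proof (rule sum.mono_neutral_right)
    show "finite {(n, l). n + l < Suc M}"
      by (rule finite_subset[of _ "{..M} \<times> {..M}"]) auto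
  qed (auto simp: f_def b_0 intro!: gr0I)
  also have "\<dots> \<le> (\<Sum>(n, l)\<in>{..<Suc M} \<times> {..<M}. f n l)"
    by (rule sum_mono2) (auto simp: f_nonneg)
  also have "\<dots> = (\<Sum>l<M. \<Sum>n<Suc M. f n l)"
    unfolding sum.cartesian_product[symmetric] by (rule sum.swap)
  also have "\<dots> = (\<Sum>l<M. \<omega> l * (\<Sum>n<Suc M. b n * branch_energy n l))"
    unfolding f_def sum_distrib_left by (simp only: mult_ac)
  also have "\<dots> \<le> (\<Sum>l<M. \<omega> l * ((\<Sum>j<t. (cmod (fps_nth (F j) l))\<^sup>2) + state_energy l
      - (\<Sum>i<s. (cmod (fps_nth (out_series i) l))\<^sup>2)))"
    using output_plus_branch_energy_le[of _ "Suc M"]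
    by (intro sum_mono mult_left_mono) (simp_all add: weight_pos less_imp_le algebra_simps)
  finally show ?thesis
    by (simp add: algebra_simps sum.distrib sum_subtractf)
qed

corollary output_energy_le:
  "(\<Sum>k<M. \<omega> k * (\<Sum>i<s. (cmod (fps_nth (out_series i) k))\<^sup>2))
    \<le> (\<Sum>k<M. \<omega> k * (\<Sum>j<t. (cmod (fps_nth (F j) k))\<^sup>2))"
proof -
  have "0 \<le> \<omega> M * state_energy M"
    using weight_pos[of M] by (simp add: state_energy_def state.self_nonneg)
  with energy_inequality[of M] show ?thesis by simp
qed

text \<open>
  The energy inequality also controls the state at time \<open>k\<close>, hence the seminorm of the current signal,
  and so by Cauchy-Schwarz its inner products with the \<open>dual_vec c\<close>. This is needed to evaluate the
  impulse responses at the nodes.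
\<close>

lemma proj_coeff_bound:
  "\<omega> k * (cmod (fps_nth (proj_coeff c) k))\<^sup>2
    \<le> Re (ip (dual_vec c) (dual_vec c)) * (\<Sum>l\<le>k. \<omega> l * (\<Sum>j<t. (cmod (fps_nth (F j) l))\<^sup>2))"
proof -
  have "\<omega> k * (cmod (fps_nth (proj_coeff c) k))\<^sup>2
      \<le> \<omega> k * (Re (ip (signal k) (signal k)) * Re (ip (dual_vec c) (dual_vec c)))"
    unfolding proj_coeff_nth by (intro mult_left_mono Cauchy_Schwarz less_imp_le[OF weight_pos])
  also have "\<dots> = Re (ip (dual_vec c) (dual_vec c)) * (\<omega> k * Re (ip (signal k) (signal k)))"
    by (simp only: mult_ac)
  also have "\<dots> \<le> Re (ip (dual_vec c) (dual_vec c)) * (\<Sum>l\<le>k. \<omega> l * (\<Sum>j<t. (cmod (fps_nth (F j) l))\<^sup>2))"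
  proof (intro mult_left_mono self_nonneg)
    have "0 \<le> (\<Sum>l<k. \<omega> l * (\<Sum>i<s. (cmod (fps_nth (out_series i) l))\<^sup>2))"
      by (intro sum_nonneg mult_nonneg_nonneg less_imp_le[OF weight_pos]) auto
    with energy_inequality[of k]
    show "\<omega> k * Re (ip (signal k) (signal k)) \<le> (\<Sum>l\<le>k. \<omega> l * (\<Sum>j<t. (cmod (fps_nth (F j) l))\<^sup>2))"
      by (simp add: signal_energy algebra_simps lessThan_Suc_atMost[symmetric])
  qed
  finally show ?thesis .
qed

end

lemma unit_input:
  assumes "j < t"
  shows "proj_coeff (\<lambda>j'. if j' = j then 1 else 0) c = response j c"
    and "out_series (\<lambda>j'. if j' = j then 1 else 0) i = transfer i j"
  using assms by (simp_all add: proj_coeff_def out_series_def mult_delta_right)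

lemma response_bounded:
  assumes "j < t"
  shows "cmod (fps_nth (response j c) k) \<le> sqrt (Re (ip (dual_vec c) (dual_vec c)) * \<omega> 0)"
proof (rule real_le_rsqrt)
  let ?F = "\<lambda>j'. if j' = j then 1 else 0 :: complex fps"
  have input: "(\<Sum>j'<t. (cmod (fps_nth (?F j') l))\<^sup>2) = (if l = 0 then 1 else 0)" for l
  proof -
    have "(\<Sum>j'<t. (cmod (fps_nth (?F j') l))\<^sup>2) = (\<Sum>j'<t. if j' = j then if l = 0 then 1 else 0 else 0)"
      by (intro sum.cong refl) auto
    then show ?thesis using assms by simp
  qed
  have "(cmod (fps_nth (response j c) k))\<^sup>2 \<le> \<omega> k * (cmod (fps_nth (response j c) k))\<^sup>2"
    using mult_right_mono[OF weight_ge_1[of k], of "(cmod (fps_nth (response j c) k))\<^sup>2"] by simp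
  also have "\<dots> \<le> Re (ip (dual_vec c) (dual_vec c)) * \<omega> 0"
    using proj_coeff_bound[of k ?F c]
    by (simp only: unit_input[OF assms] input) (simp add: mult_delta_right)
  finally show "(cmod (fps_nth (response j c) k))\<^sup>2 \<le> Re (ip (dual_vec c) (dual_vec c)) * \<omega> 0" .
qed

text \<open>
  Evaluate \<open>output_nth\<close> for a unit impulse at \<open>z a\<close>. By the Cauchy product \<open>state_series q\<close> has there
  the value \<open>L a q\<close> times the value of the impulse response, and the correction terms vanish.
\<close>

theorem transfer_interpolates:
  assumes a: "a < m" and j: "j < t"
  shows "(\<lambda>k. fps_nth (transfer (\<iota> a) j) k * z a ^ k) sums W a j"
proof -
  let ?F = "\<lambda>j'. if j' = j then 1 else 0 :: complex fps"
  define C where "C q = (\<Sum>k. fps_nth (response j q) k * z a ^ k)" for q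
  have summ: "summable (\<lambda>k. cmod (fps_nth (response j q) k * z a ^ k))" for q
    by (rule norm_summable_bounded_coeffs[OF response_bounded[OF j] z_disc[OF a]])
  have C: "(\<lambda>k. fps_nth (response j q) k * z a ^ k) sums C q" for q
    unfolding C_def by (rule summable_sums[OF summable_norm_cancel[OF summ]])
  have state: "(\<lambda>k. fps_nth (state_series ?F q) k * z a ^ k) sums (L a q * C q)" if q: "q < m" for q
  proof -
    have "(\<lambda>k. \<Sum>n\<le>k. of_real (b n) * cnj (z q) ^ n * z a ^ n
          * (fps_nth (response j q) (k - n) * z a ^ (k - n)))
        sums ((\<Sum>n. of_real (b n) * cnj (z q) ^ n * z a ^ n) * C q)"
      unfolding C_def by (rule Cauchy_product_sums[OF L_norm_summable[OF a q] summ])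
    also have "(\<Sum>n. of_real (b n) * cnj (z q) ^ n * z a ^ n) = L a q"
      by (simp add: L_def power_mult_distrib mult_ac)
    also have "(\<lambda>k. \<Sum>n\<le>k. of_real (b n) * cnj (z q) ^ n * z a ^ n
          * (fps_nth (response j q) (k - n) * z a ^ (k - n)))
        = (\<lambda>k. fps_nth (state_series ?F q) k * z a ^ k)"
    proof
      fix k
      have term_eq: "of_real (b n) * cnj (z q) ^ n * z a ^ n * (fps_nth (response j q) (k - n) * z a ^ (k - n))
          = of_real (b n) * cnj (z q) ^ n * fps_nth (response j q) (k - n) * z a ^ k" if "n \<le> k" for n
      proof -
        have "z a ^ k = z a ^ n * z a ^ (k - n)"
          using that by (simp flip: power_add)
        then show ?thesis by (simp only: mult_ac)
      qed
      have "(\<Sum>n\<le>k. of_real (b n) * cnj (z q) ^ n * z a ^ n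
          * (fps_nth (response j q) (k - n) * z a ^ (k - n)))
          = (\<Sum>n\<le>k. of_real (b n) * cnj (z q) ^ n * fps_nth (response j q) (k - n) * z a ^ k)"
        by (rule sum.cong[OF refl], rule term_eq) simp
      also have "\<dots> = fps_nth (state_series ?F q) k * z a ^ k"
        by (simp add: state_series_def unit_input[OF j] fps_mult_nth feedback_def sum_distrib_right
            atLeast0AtMost)
      finally show "(\<Sum>n\<le>k. of_real (b n) * cnj (z q) ^ n * z a ^ n
          * (fps_nth (response j q) (k - n) * z a ^ (k - n)))
          = fps_nth (state_series ?F q) k * z a ^ k" .
    qed
    finally show ?thesis .
  qed
  have "(\<lambda>k. fps_nth (transfer (\<iota> a) j) k * z a ^ k)
      = (\<lambda>k. (if k = 0 then W a j else 0)
          + (\<Sum>q<m. P a q * (fps_nth (state_series ?F q) k * z a ^ k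
              - L a q * (fps_nth (response j q) k * z a ^ k))))"
  proof
    fix k
    have "(\<Sum>j'<t. W a j' * fps_nth (?F j') k) = (\<Sum>j'<t. if j' = j then if k = 0 then W a j else 0 else 0)"
      by (intro sum.cong refl) auto
    then have "(\<Sum>j'<t. W a j' * fps_nth (?F j') k) = (if k = 0 then W a j else 0)"
      using j by simp
    with output_nth[OF a, of ?F k]
    have "fps_nth (transfer (\<iota> a) j) k = (if k = 0 then W a j else 0)
        + (\<Sum>q<m. P a q * (fps_nth (state_series ?F q) k - L a q * fps_nth (response j q) k))"
      by (simp only: unit_input[OF j])
    then show "fps_nth (transfer (\<iota> a) j) k * z a ^ k = (if k = 0 then W a j else 0)
          + (\<Sum>q<m. P a q * (fps_nth (state_series ?F q) k * z a ^ k
              - L a q * (fps_nth (response j q) k * z a ^ k)))"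
      by (simp add: distrib_left sum_distrib_left right_diff_distrib mult_ac)
  qed
  moreover have "\<dots> sums (W a j + (\<Sum>q<m. P a q * (L a q * C q - L a q * C q)))"
  proof (rule sums_add)
    show "(\<lambda>k. if k = 0 then W a j else 0) sums W a j"
      using sums_single[of 0 "\<lambda>_. W a j"] by simp
    show "(\<lambda>k. \<Sum>q<m. P a q * (fps_nth (state_series ?F q) k * z a ^ k
              - L a q * (fps_nth (response j q) k * z a ^ k)))
        sums (\<Sum>q<m. P a q * (L a q * C q - L a q * C q))"
    proof (rule sums_sum)
      fix q assume "q \<in> {..<m}"
      then have q: "q < m" by simp
      show "(\<lambda>k. P a q * (fps_nth (state_series ?F q) k * z a ^ k
              - L a q * (fps_nth (response j q) k * z a ^ k)))
          sums (P a q * (L a q * C q - L a q * C q))"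
        by (rule sums_mult, rule sums_diff, rule state[OF q], rule sums_mult, rule C)
    qed
  qed
  ultimately show ?thesis by simp
qed

end

section \<open>The derivative Hardy space\<close>

lemma S12_weight_ge_1: "1 \<le> S12_weight n"
  by (simp add: S12_weight_def algebra_simps)

text \<open>
  The ratio of consecutive kernel coefficients is \<open>(k + 1) / (k + 3)\<close>, which increases with \<open>k\<close>.
\<close>

lemma inverse_S12_weight_log_convex:
  "(1 / S12_weight (Suc k))\<^sup>2 \<le> 1 / S12_weight k * (1 / S12_weight (Suc (Suc k)))"
proof -
  have "S12_weight k * S12_weight (Suc (Suc k)) \<le> (S12_weight (Suc k))\<^sup>2"
    by (simp add: S12_weight_def power2_eq_square field_simps)
  moreover have "0 < S12_weight k * S12_weight (Suc (Suc k))"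
    using S12_weight_ge_1[of k] S12_weight_ge_1[of "Suc (Suc k)"] by simp
  ultimately show ?thesis
    by (simp add: power_divide frac_le)
qed

definition S12_b :: "nat \<Rightarrow> real" where
  "S12_b = renewal_seq (\<lambda>n. 1 / S12_weight n)"

lemma S12_b_nonneg: "0 \<le> S12_b n"
  unfolding S12_b_def
proof (rule Kaluza)
  show "0 < 1 / S12_weight k" for k
    using S12_weight_ge_1[of k] by simp
  show "(1 / S12_weight (Suc k))\<^sup>2 \<le> 1 / S12_weight k * (1 / S12_weight (Suc (Suc k)))" for k
    by (rule inverse_S12_weight_log_convex)
qed (simp add: S12_weight_def)

lemma S12_renewal: "1 \<le> k \<Longrightarrow> 1 / S12_weight k = (\<Sum>n=1..k. S12_b n / S12_weight (k - n))"
  using renewal_equation[of "\<lambda>n. 1 / S12_weight n" k] by (simp add: S12_b_def) (simp add: S12_weight_def)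

lemma S12_b_le_1: "S12_b n \<le> 1"
proof (cases "n = 0")
  case False
  have "S12_b n * (1 / S12_weight 0) \<le> 1 / S12_weight n"
    by (rule renewal_coeff_le[where a = "\<lambda>n. 1 / S12_weight n"])
       (use False S12_renewal[of n] S12_b_nonneg in \<open>auto simp: S12_weight_def\<close>)
  also have "\<dots> \<le> 1" using S12_weight_ge_1[of n] by simp
  finally show ?thesis by (simp add: S12_weight_def)
qed (simp add: S12_b_def renewal_seq_0)

lemma S12_kernel_reciprocal:
  assumes "w \<in> unit_disc" "z \<in> unit_disc"
  shows "S12_kernel w z * (1 - (\<Sum>n. of_real (S12_b n) * (z * cnj w) ^ n)) = 1"
proof -
  have x: "cmod (z * cnj w) < 1"
    using mult_strict_mono[of "cmod z" 1 "cmod w" 1] assms by (simp add: norm_mult)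
  have "S12_kernel w z = (\<Sum>n. of_real (1 / S12_weight n) * (z * cnj w) ^ n)"
    by (simp add: S12_kernel_def S12_weight_def mult.commute)
  then show ?thesis
    using renewal_generating_function[of "\<lambda>n. 1 / S12_weight n" "z * cnj w"] x
      S12_weight_ge_1 S12_b_nonneg S12_b_le_1
    by (simp add: S12_b_def[symmetric] abs_le_iff) (simp add: S12_weight_def S12_weight_ge_1)
qed

lemma mat_adjoint_index:
  "i < dim_col A \<Longrightarrow> j < dim_row A \<Longrightarrow> mat_adjoint A $$ (i, j) = cnj (A $$ (j, i))"
  "dim_row (mat_adjoint A) = dim_col A" "dim_col (mat_adjoint A) = dim_row A"
  for A :: "complex mat"
  by (simp_all add: mat_adjoint_def mat_of_rows_index cols_def)

lemma psd_mat_hermitian: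
  assumes "psd_mat n A" "p < n" "q < n"
  shows "A $$ (q, p) = cnj (A $$ (p, q))"
proof -
  have A: "A \<in> carrier_mat n n" "mat_adjoint A = A"
    using assms(1) by (simp_all add: psd_mat_def)
  then have "A $$ (q, p) = mat_adjoint A $$ (q, p)" by simp
  then show ?thesis using A(1) assms by (simp add: mat_adjoint_index)
qed

lemma psd_mat_quadratic_form:
  assumes "psd_mat n A"
  shows "0 \<le> Re (\<Sum>p<n. \<Sum>q<n. A $$ (p, q) * x q * cnj (x p))"
proof -
  have A: "A \<in> carrier_mat n n"
    using assms by (simp add: psd_mat_def)
  have "(A *\<^sub>v vec n x) \<bullet>c vec n x = (\<Sum>p<n. \<Sum>q<n. A $$ (p, q) * x q * cnj (x p))"
    using A by (simp add: scalar_prod_def sum_distrib_right atLeast0LessThan)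
  moreover have "0 \<le> Re ((A *\<^sub>v vec n x) \<bullet>c vec n x)"
    using assms by (simp add: psd_mat_def)
  ultimately show ?thesis by simp
qed

text \<open>
  The flattened index \<open>p\<close> stands for row \<open>p mod s\<close> of the target matrix at node \<open>p div s\<close>; this is
  the indexing that \<open>pick_data\<close> abstracts from.
\<close>

lemma pick_matrix_index:
  assumes "p < N * s" "q < N * s" and W: "\<And>i. i < N \<Longrightarrow> W i \<in> carrier_mat s t"
  shows "pick_matrix K s N \<zeta> W $$ (p, q)
    = ((if p mod s = q mod s then 1 else 0)
        - (\<Sum>j<t. W (p div s) $$ (p mod s, j) * cnj (W (q div s) $$ (q mod s, j))))
      * K (\<zeta> (q div s)) (\<zeta> (p div s))"
proof -
  have s: "0 < s" using assms(1) by (cases s) auto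
  have "p div s < N" "q div s < N"
    using assms(1,2) by (simp_all add: less_mult_imp_div_less)
  then have "W (p div s) \<in> carrier_mat s t" "W (q div s) \<in> carrier_mat s t"
    using W by auto
  then show ?thesis
    using assms(1,2) s
    by (simp add: pick_matrix_def mat_adjoint_index scalar_prod_def atLeast0LessThan)
qed

text \<open>
  The interpolant is the transfer function. It is holomorphic because its coefficients are bounded, and
  the coefficients of \<open>\<Phi> F\<close> are the convolutions to which the energy inequality applies.
\<close>

theorem S12_matrix_pick_property: "matrix_pick_property unit_disc S12 S12_norm S12_kernel s t"
  unfolding matrix_pick_property_def
proof (intro allI impI)
  fix N :: nat and \<zeta> :: "nat \<Rightarrow> complex" and W :: "nat \<Rightarrow> complex mat"
  assume \<zeta>: "\<zeta> ` {..<N} \<subseteq> unit_disc" and W: "\<forall>i<N. W i \<in> carrier_mat s t"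
    and psd: "psd_mat (N * s) (pick_matrix S12_kernel s N \<zeta> W)"
  define P where "P p q = pick_matrix S12_kernel s N \<zeta> W $$ (p, q)" for p q
  define V where "V p j = W (p div s) $$ (p mod s, j)" for p j
  have div: "p div s < N" and mod: "p mod s < s" if "p < N * s" for p
    using that by (cases s; simp add: less_mult_imp_div_less)+
  interpret pick_data S12_weight S12_b "N * s" s t "\<lambda>p. \<zeta> (p div s)" "\<lambda>p. p mod s" V P
  proof
    show "1 \<le> S12_weight k" for k by (rule S12_weight_ge_1)
    show "0 \<le> S12_b n" for n by (rule S12_b_nonneg)
    show "S12_b 0 = 0" by (simp add: S12_b_def renewal_seq_0)
    show "1 / S12_weight k = (\<Sum>n=1..k. S12_b n / S12_weight (k - n))" if "1 \<le> k" for k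
      using that by (rule S12_renewal)
    show "cmod (\<zeta> (p div s)) < 1" if "p < N * s" for p
      using \<zeta> div[OF that] by (auto simp: image_subset_iff)
    show "p mod s < s" if "p < N * s" for p
      using that by (rule mod)
    show "P q p = cnj (P p q)" if "p < N * s" "q < N * s" for p q
      unfolding P_def using psd that by (rule psd_mat_hermitian)
    show "0 \<le> Re (\<Sum>p<N * s. \<Sum>q<N * s. P p q * x q * cnj (x p))" for x
      unfolding P_def using psd by (rule psd_mat_quadratic_form)
    show "P p q * (1 - (\<Sum>n. of_real (S12_b n) * (\<zeta> (p div s) * cnj (\<zeta> (q div s))) ^ n))
        = (if p mod s = q mod s then 1 else 0) - (\<Sum>j<t. V p j * cnj (V q j))"
      if "p < N * s" "q < N * s" for p q
    proof -
      have "S12_kernel (\<zeta> (q div s)) (\<zeta> (p div s))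
          * (1 - (\<Sum>n. of_real (S12_b n) * (\<zeta> (p div s) * cnj (\<zeta> (q div s))) ^ n)) = 1"
        using \<zeta> div[OF that(1)] div[OF that(2)] by (intro S12_kernel_reciprocal) auto
      then show ?thesis
        using W by (simp add: P_def V_def pick_matrix_index[OF that, where t = t] mult.assoc)
    qed
  qed
  define \<Phi> where "\<Phi> x = mat s t (\<lambda>(i, j). eval_fps (transfer i j) x)" for x
  have radius: "1 \<le> fps_conv_radius (transfer i j)" if j: "j < t" for i j
  proof (rule fps_conv_radius_bounded_coeffs)
    fix k
    show "cmod (fps_nth (transfer i j) k)
        \<le> (\<Sum>c<N * s. sqrt (Re (ip (dual_vec c) (dual_vec c)) * S12_weight 0))"
      unfolding transfer_def fps_sum_nth
      using response_bounded[OF j]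
      by (intro sum_norm_le) (auto simp: S12_weight_def self_nonneg)
  qed
  have "\<Phi> (\<zeta> i) = W i" if i: "i < N" for i
  proof (rule eq_matI)
    have Wi: "W i \<in> carrier_mat s t" using W i by simp
    then show "dim_row (\<Phi> (\<zeta> i)) = dim_row (W i)" "dim_col (\<Phi> (\<zeta> i)) = dim_col (W i)"
      by (simp_all add: \<Phi>_def)
    fix \<alpha> j assume "\<alpha> < dim_row (W i)" "j < dim_col (W i)"
    with Wi have \<alpha>: "\<alpha> < s" and j: "j < t" by auto
    \<comment> \<open>The flattened index of row \<open>\<alpha>\<close> at node \<open>i\<close>.\<close>
    define a where "a = i * s + \<alpha>"
    have "a < Suc i * s" using \<alpha> by (simp add: a_def)
    also have "\<dots> \<le> N * s" using i by (intro mult_right_mono) auto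
    finally have a: "a < N * s" .
    have [simp]: "a div s = i" "a mod s = \<alpha>"
      using \<alpha> by (simp_all add: a_def)
    show "\<Phi> (\<zeta> i) $$ (\<alpha>, j) = W i $$ (\<alpha>, j)"
      using transfer_interpolates[OF a j] \<alpha> j
      by (simp add: \<Phi>_def V_def eval_fps_def sums_iff)
  qed
  moreover have "contractive_multiplier unit_disc S12 S12_norm s t \<Phi>"
    unfolding contractive_multiplier_def
  proof (intro conjI ballI allI impI)
    show "\<Phi> x \<in> carrier_mat s t" for x by (simp add: \<Phi>_def)
    fix F :: "nat \<Rightarrow> complex \<Rightarrow> complex"
    assume "\<forall>j<t. F j \<in> S12"
    then have F: "F j holomorphic_on unit_disc"
        "summable (\<lambda>n. S12_weight n * (cmod (taylor_coeff (F j) n))\<^sup>2)" if "j < t" for j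
      using that by (auto simp: S12_def)
    define f where "f j = fps_expansion (F j) 0" for j
    have F_exp: "F j has_fps_expansion f j" if "j < t" for j
      unfolding f_def using F(1)[OF that] by (intro has_fps_expansion_fps_expansion) auto
    have coeff_F: "taylor_coeff (F j) k = fps_nth (f j) k" if "j < t" for j k
      using fps_nth_fps_expansion[OF F_exp[OF that]] by (simp add: taylor_coeff_def)
    have G_eq: "mult_op t \<Phi> F i = (\<lambda>x. \<Sum>j<t. eval_fps (transfer i j) x * F j x)" if "i < s" for i
      using that by (auto simp: mult_op_def \<Phi>_def)
    have G_holo: "mult_op t \<Phi> F i holomorphic_on unit_disc" if "i < s" for i
      unfolding G_eq[OF that]
    proof (intro holomorphic_on_sum holomorphic_on_mult holomorphic_on_eval_fps)
      fix j assume "j \<in> {..<t}"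
      then have j: "j < t" by simp
      show "F j holomorphic_on unit_disc" by (rule F(1)[OF j])
      show "unit_disc \<subseteq> eball 0 (fps_conv_radius (transfer i j))"
      proof
        fix x assume "x \<in> unit_disc"
        then have "ereal (cmod x) < 1" by simp
        also note radius[OF j, of i]
        finally show "x \<in> eball 0 (fps_conv_radius (transfer i j))"
          by (simp add: in_eball_iff)
      qed
    qed
    have coeff_G: "taylor_coeff (mult_op t \<Phi> F i) k = fps_nth (out_series f i) k" if "i < s" for i k
    proof -
      have "mult_op t \<Phi> F i has_fps_expansion out_series f i"
        unfolding G_eq[OF that] out_series_def
      proof (intro has_fps_expansion_sum has_fps_expansion_mult)
        fix j assume "j \<in> {..<t}"
        then have j: "j < t" by simp
        show "F j has_fps_expansion f j" by (rule F_exp[OF j])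
        show "eval_fps (transfer i j) has_fps_expansion transfer i j"
          by (rule eval_fps_has_fps_expansion, rule less_le_trans[OF _ radius[OF j]]) simp
      qed
      from fps_nth_fps_expansion[OF this] show ?thesis by (simp add: taylor_coeff_def)
    qed
    let ?wF = "\<lambda>j n. S12_weight n * (cmod (taylor_coeff (F j) n))\<^sup>2"
    let ?wG = "\<lambda>i n. S12_weight n * (cmod (taylor_coeff (mult_op t \<Phi> F i) n))\<^sup>2"
    have w_nonneg: "0 \<le> S12_weight n * (cmod c)\<^sup>2" for n c
      using S12_weight_ge_1[of n] by simp
    have norm2: "(S12_norm g)\<^sup>2 = (\<Sum>n. S12_weight n * (cmod (taylor_coeff g n))\<^sup>2)"
      if "summable (\<lambda>n. S12_weight n * (cmod (taylor_coeff g n))\<^sup>2)" for g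
      unfolding S12_norm_def using suminf_nonneg[OF that w_nonneg] by simp
    have partial: "(\<Sum>n<M. \<Sum>i<s. ?wG i n) \<le> (\<Sum>j<t. (S12_norm (F j))\<^sup>2)" for M
    proof -
      have "(\<Sum>n<M. \<Sum>i<s. ?wG i n) = (\<Sum>k<M. S12_weight k * (\<Sum>i<s. (cmod (fps_nth (out_series f i) k))\<^sup>2))"
        by (simp add: coeff_G sum_distrib_left)
      also have "\<dots> \<le> (\<Sum>k<M. S12_weight k * (\<Sum>j<t. (cmod (fps_nth (f j) k))\<^sup>2))"
        by (rule output_energy_le)
      also have "\<dots> = (\<Sum>k<M. \<Sum>j<t. ?wF j k)"
        by (simp add: coeff_F sum_distrib_left)
      also have "\<dots> = (\<Sum>j<t. \<Sum>k<M. ?wF j k)"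
        by (rule sum.swap)
      also have "\<dots> \<le> (\<Sum>j<t. (S12_norm (F j))\<^sup>2)"
        by (intro sum_mono) (auto simp: norm2 F w_nonneg intro!: sum_le_suminf)
      finally show ?thesis .
    qed
    have G_summable: "summable (?wG i)" if "i < s" for i
    proof (rule summableI_nonneg_bounded)
      show "0 \<le> ?wG i n" for n by (rule w_nonneg)
      show "(\<Sum>n<M. ?wG i n) \<le> (\<Sum>j<t. (S12_norm (F j))\<^sup>2)" for M
        using that by (intro order.trans[OF sum_mono partial] member_le_sum w_nonneg) auto
    qed
    show "mult_op t \<Phi> F i \<in> S12" if "i < s" for i
      using G_holo[OF that] G_summable[OF that] by (simp add: S12_def)
    have "(\<Sum>i<s. (S12_norm (mult_op t \<Phi> F i))\<^sup>2) = (\<Sum>n. \<Sum>i<s. ?wG i n)"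
      using suminf_sum[of "{..<s}" ?wG] G_summable by (simp add: norm2)
    also have "\<dots> \<le> (\<Sum>j<t. (S12_norm (F j))\<^sup>2)"
      using G_summable partial by (intro suminf_le_const summable_sum) auto
    finally show "tuple_norm S12_norm s (mult_op t \<Phi> F) \<le> tuple_norm S12_norm t F"
      by (simp add: tuple_norm_def)
  qed
  ultimately show "\<exists>\<Phi>. contractive_multiplier unit_disc S12 S12_norm s t \<Phi> \<and> (\<forall>i<N. \<Phi> (\<zeta> i) = W i)"
    by blast
qed

theorem theorem5p4:
  shows "complete_pick_property unit_disc S12 S12_norm S12_kernel"
  by (simp add: complete_pick_property_def S12_matrix_pick_property)

end
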